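(* Let $d\geq 2$ be an integer. There exists a dense forest $F\subset\mathbb{R}^d$ with a visibility function $V:\mathbb{R}_{>0}\to\mathbb{R}_{\geq 0}$ satisfying $$V(\varepsilon)\in O\left(\varepsilon^{-(d-1)}\ln \varepsilon^{-1}\right)\quad\text{as }\varepsilon\to 0^+,$$ where the constant implied by the big-$O$ notation depends on the dimension $d$ only.
   Context: $\|\cdot\|$ denotes the Euclidean norm on $\mathbb{R}^d$, $B(x,T)$ the ball of radius $T$ centred at $x$, $S^{d-1}$ the unit sphere in $\mathbb{R}^d$, and $\#(\cdot)$ the cardinality of a set. A set of points $X\subset\mathbb{R}^d$ has finite density if $$\lim_{T\to\infty}\frac{\#(X\cap B(0,T))}{T^d}<\infty.$$ Given a set of points $F\subset\mathbb{R}^d$, $x\in\mathbb{R}^d$, $v\in S^{d-1}$ and $\varepsilon>0$, the visibility in $F$ at scale $\varepsilon$ from $x$ in direction $v$ is the smallest $t\in\mathbb{R}_{\geq 0}$ such that $\|x+tv-y\|\leq\varepsilon$ for some $y\in F$. A set of points $F\subset\mathbb{R}^d$ is a dense forest if it has finite density and there exists a function $V:\mathbb{R}_{>0}\to\mathbb{R}_{\geq 0}$ (called a visibility function of $F$) such that for any $x\in\mathbb{R}^d$, $v\in S^{d-1}$ and $\varepsilon>0$, the visibility in $F$ at scale $\varepsilon$ from $x$ in direction $v$ is at most $V(\varepsilon)$ (in particular, such a $t$ exists). *)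

theory Defs
  imports "HOL-Analysis.Analysis" "HOL-Library.Landau_Symbols"
begin

text \<open>
  Finite density means that the limit exists as a real number. The finiteness conjunct is needed
  because \<^const>\<open>card\<close> is 0 on infinite sets: an infinite intersection with some ball has to
  count as infinite density. It makes no difference to the limit whether the balls are open or
  closed.
\<close>

definition finite_density :: "(real ^ 'n::finite) set \<Rightarrow> bool" where
  "finite_density X \<longleftrightarrow>
     (\<forall>T. finite (X \<inter> ball 0 T)) \<and>
     (\<exists>L::real. ((\<lambda>T. real (card (X \<inter> ball 0 T)) / T ^ CARD('n)) \<longlongrightarrow> L) at_top)"

text \<open>
  The visibility is introduced as a relation, since the smallest \<open>t\<close> need not exist for an
  arbitrary set \<open>F\<close>; it is unique when it exists.
\<close>

definition is_visibility ::
    "(real ^ 'n::finite) set \<Rightarrow> real \<Rightarrow> real ^ 'n \<Rightarrow> real ^ 'n \<Rightarrow> real \<Rightarrow> bool" where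
  "is_visibility F \<epsilon> x v t \<longleftrightarrow>
     t \<ge> 0 \<and> (\<exists>y\<in>F. norm (x + t *\<^sub>R v - y) \<le> \<epsilon>) \<and>
     (\<forall>s\<ge>0. (\<exists>y\<in>F. norm (x + s *\<^sub>R v - y) \<le> \<epsilon>) \<longrightarrow> t \<le> s)"

text \<open>Only the values of \<open>V\<close> at positive reals are meaningful.\<close>

definition visibility_function :: "(real ^ 'n::finite) set \<Rightarrow> (real \<Rightarrow> real) \<Rightarrow> bool" where
  "visibility_function F V \<longleftrightarrow>
     (\<forall>\<epsilon>>0. V \<epsilon> \<ge> 0) \<and>
     (\<forall>x. \<forall>v\<in>sphere 0 1. \<forall>\<epsilon>>0. \<exists>t. is_visibility F \<epsilon> x v t \<and> t \<le> V \<epsilon>)"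

definition dense_forest :: "(real ^ 'n::finite) set \<Rightarrow> bool" where
  "dense_forest F \<longleftrightarrow> finite_density F \<and> (\<exists>V. visibility_function F V)"

end

theory Submission
  imports Defs "HOL-Probability.Probability" "HOL-Real_Asymp.Real_Asymp"
begin

text \<open>
  Write \<open>d\<close> for the dimension and call the integer points \<open>z\<close> cells. The forest is random and is
  repaired afterwards. Every cell carries one point \<open>z + \<omega>(z)\<close>, where the offsets \<open>\<omega>(z)\<close> are
  independent and uniform in a fixed ball. At scale \<open>\<epsilon> = 2\<^sup>-\<^sup>k\<^sup>-\<^sup>1\<close> a unit stretch of a ray is
  \<open>\<epsilon>\<close>-close to the point of a given nearby cell with probability about \<open>\<epsilon>\<^bsup>d-1\<^esup>\<close>, and stretches at
  distance \<open>d\<close> from each other use different cells. A ray of length \<open>C (k+1) 2\<^bsup>k(d-1)\<^esup>\<close> therefore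
  misses all points with probability at most \<open>exp(- c C (k+1))\<close>. A net of \<open>exp(O(k))\<close> rays
  represents all rays that start in a fixed cell, so a cell has some unlucky ray at scale \<open>k\<close> with a
  probability that decays geometrically in \<open>k\<close>, as fast as desired if \<open>C\<close> is large.

  A single random point set thus serves all scales, and this is where the bound without loss comes
  from: reserving a separate part of the density for each scale would cost the inverse of that part
  in the visibility. Unlucky cells can occur at every scale. Such a cell is repaired by adding the
  starting points of the rays in its net: whoever starts in the cell then sees a point at once. The
  net has \<open>exp(O(k))\<close> elements while unlucky cells have frequency \<open>exp(- c C k + O(k))\<close>, so the
  repairs at all scales together have finite expected density.

  It remains to turn expected density into density. For this, space is cut into the annuli
  \<open>i\<^sup>2 \<le> \<parallel>y\<parallel> < (i+1)\<^sup>2\<close>, which contain about \<open>i\<^bsup>2d-1\<^esup>\<close> cells. Distant cells behave independently, so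
  Chebyshev's inequality bounds the probability that an annulus has far too many unlucky cells at
  scale \<open>k\<close> by a multiple of \<open>2\<^sup>-\<^sup>k (i+1)\<^sup>-\<^sup>2\<close>; the sum over all scales and annuli is below 1 (lemma
  \<open>exists_outcome_few_bad\<close>). Some outcome is therefore good for all of them, and in it the \<open>i\<close>-th
  annulus contains at most \<open>K ((i+1)\<^bsup>2d\<^esup> - i\<^bsup>2d\<^esup>)\<close> points for a constant \<open>K\<close> (lemma
  \<open>exists_random_forest\<close>). Additional points never increase the visibility, so each annulus can be filled
  up to exactly this number. The ball of radius \<open>i\<^sup>2\<close> then contains exactly \<open>K i\<^bsup>2d\<^esup>\<close> points, and
  because consecutive radii have ratio tending to 1, the density converges.
\<close>

section \<open>Deviations of the number of bad events\<close>

text \<open>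
  Chebyshev's inequality for a sum of indicators. A pair contributes a covariance of at most \<open>p\<close>,
  and only the at most \<open>\<nu>\<close> dependent partners of each event contribute at all, so the variance grows
  linearly in the number of events.
\<close>

lemma (in prob_space) count_events_deviation:
  fixes A :: "'z \<Rightarrow> 'a set"
  assumes fin: "finite Z" and ev: "\<And>z. z \<in> Z \<Longrightarrow> A z \<in> events"
    and p: "\<And>z. z \<in> Z \<Longrightarrow> prob (A z) \<le> p"
    and dep: "\<And>z. z \<in> Z \<Longrightarrow>
      card {y \<in> Z. prob (A z \<inter> A y) \<noteq> prob (A z) * prob (A y)} \<le> \<nu>"
    and "l > 0"
  shows "prob {\<omega> \<in> space M. real (card {z \<in> Z. \<omega> \<in> A z}) \<ge> real (card Z) * p + l}
    \<le> real (card Z) * real \<nu> * p / l\<^sup>2"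
proof -
  define f where "f = (\<lambda>\<omega>. \<Sum>z\<in>Z. indicator (A z) \<omega> :: real)"
  have [measurable]: "f \<in> borel_measurable M"
    unfolding f_def using ev by (intro borel_measurable_sum) auto
  have int: "integrable M (indicator (A z) :: 'a \<Rightarrow> real)" if "z \<in> Z" for z
    using ev[OF that] by (simp add: less_top[symmetric])
  have int2: "integrable M (indicator (A z \<inter> A y) :: 'a \<Rightarrow> real)" if "z \<in> Z" "y \<in> Z" for z y
    using ev that by (simp add: less_top[symmetric])
  have card_f: "f \<omega> = real (card {z \<in> Z. \<omega> \<in> A z})" for \<omega>
    unfolding f_def using fin by (simp add: indicator_def sum.If_cases Int_def)
  have mean: "expectation f = (\<Sum>z\<in>Z. prob (A z))"
  proof -
    have "expectation f = (\<Sum>z\<in>Z. expectation (indicator (A z)))"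
      unfolding f_def using int by (rule Bochner_Integration.integral_sum)
    then show ?thesis using ev by (simp add: sets.Int_space_eq2)
  qed
  have sq: "(f \<omega>)\<^sup>2 = (\<Sum>z\<in>Z. \<Sum>y\<in>Z. indicator (A z \<inter> A y) \<omega>)" for \<omega>
    unfolding f_def power2_eq_square by (simp add: sum_product indicator_inter_arith)
  have int_f: "integrable M f"
    unfolding f_def using int by (rule Bochner_Integration.integrable_sum)
  have int_sq: "integrable M (\<lambda>\<omega>. (f \<omega>)\<^sup>2)"
    unfolding sq by (intro Bochner_Integration.integrable_sum int2)
  have "expectation (\<lambda>\<omega>. (f \<omega>)\<^sup>2) = (\<Sum>z\<in>Z. \<Sum>y\<in>Z. prob (A z \<inter> A y))"
    unfolding sq using ev int2
    by (simp add: Bochner_Integration.integral_sum Bochner_Integration.integrable_sum sets.Int_space_eq2)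
  then have "variance f = (\<Sum>z\<in>Z. \<Sum>y\<in>Z. prob (A z \<inter> A y) - prob (A z) * prob (A y))"
    using variance_eq[OF int_f int_sq] mean
    by (simp add: power2_eq_square sum_product sum_subtractf)
  also have "\<dots> \<le> (\<Sum>z\<in>Z. real \<nu> * p)"
  proof (rule sum_mono)
    fix z assume z: "z \<in> Z"
    let ?D = "{y \<in> Z. prob (A z \<inter> A y) \<noteq> prob (A z) * prob (A y)}"
    have p0: "0 \<le> p" using p[OF z] measure_nonneg[of M "A z"] by linarith
    have "(\<Sum>y\<in>Z. prob (A z \<inter> A y) - prob (A z) * prob (A y)) \<le>
        (\<Sum>y\<in>Z. if y \<in> ?D then p else 0)"
    proof (rule sum_mono)
      fix y assume y: "y \<in> Z"
      have "prob (A z \<inter> A y) \<le> prob (A z)"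
        using ev[OF z] by (intro finite_measure_mono) auto
      then have "prob (A z \<inter> A y) - prob (A z) * prob (A y) \<le> p"
        using p[OF z] mult_nonneg_nonneg[OF measure_nonneg[of M "A z"] measure_nonneg[of M "A y"]]
        by linarith
      then show "prob (A z \<inter> A y) - prob (A z) * prob (A y) \<le> (if y \<in> ?D then p else 0)"
        using y by auto
    qed
    also have "\<dots> = real (card ?D) * p"
      using fin by (simp add: sum.If_cases Int_def)
    also have "\<dots> \<le> real \<nu> * p"
      using dep[OF z] p0 by (intro mult_right_mono) auto
    finally show "(\<Sum>y\<in>Z. prob (A z \<inter> A y) - prob (A z) * prob (A y)) \<le> real \<nu> * p" .
  qed
  finally have var: "variance f \<le> real (card Z) * real \<nu> * p" by simp
  have "prob {\<omega> \<in> space M. real (card {z \<in> Z. \<omega> \<in> A z}) \<ge> real (card Z) * p + l} \<le>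
      prob {\<omega> \<in> space M. \<bar>f \<omega> - expectation f\<bar> \<ge> l}"
  proof (rule finite_measure_mono)
    have "expectation f \<le> real (card Z) * p"
      unfolding mean using sum_bounded_above[of Z "\<lambda>z. prob (A z)" p] p by simp
    then show "{\<omega> \<in> space M. real (card {z \<in> Z. \<omega> \<in> A z}) \<ge> real (card Z) * p + l} \<subseteq>
        {\<omega> \<in> space M. \<bar>f \<omega> - expectation f\<bar> \<ge> l}"
      using card_f by force
  qed measurable
  also have "\<dots> \<le> variance f / l\<^sup>2"
    using Chebyshev_inequality[of f l] int_sq \<open>l > 0\<close> by simp
  also have "\<dots> \<le> real (card Z) * real \<nu> * p / l\<^sup>2"
    using var by (intro divide_right_mono) auto
  finally show ?thesis .
qed

text \<open>
  Here \<open>A k z\<close> is the event that cell \<open>z\<close> is bad at scale \<open>k\<close>, and \<open>Z i\<close> is the \<open>i\<close>-th region. The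
  linear variance makes the failure probability of region \<open>i\<close> inversely proportional to its size
  \<open>W i\<close>; quadratic growth of \<open>W\<close> makes this summable over the regions, and the last assumption on
  \<open>\<delta>\<close> makes it summable over the scales. The constants give a total of at most \<open>\<pi>\<^sup>2 / 24 < 1\<close>.
\<close>

lemma (in prob_space) exists_outcome_few_bad:
  fixes A :: "nat \<Rightarrow> 'z \<Rightarrow> 'a set" and Z :: "nat \<Rightarrow> 'z set" and W p \<delta> :: "nat \<Rightarrow> real"
    and \<nu> :: "nat \<Rightarrow> nat"
  assumes fin: "\<And>i. finite (Z i)" and ev: "\<And>k z. A k z \<in> events"
    and prob_le: "\<And>k z. prob (A k z) \<le> p k"
    and dep: "\<And>k i z. z \<in> Z i \<Longrightarrow>
      card {y \<in> Z i. prob (A k z \<inter> A k y) \<noteq> prob (A k z) * prob (A k y)} \<le> \<nu> k"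
    and W: "\<And>i. real (card (Z i)) \<le> W i" "\<And>i. (real i + 1)\<^sup>2 \<le> W i"
    and \<delta>: "\<And>k. 0 < \<delta> k" "\<And>k. p k \<le> \<delta> k" "\<And>k. real (\<nu> k) * p k / (\<delta> k)\<^sup>2 \<le> (1/2) ^ k / 8"
  shows "\<exists>\<omega>\<in>space M. \<forall>k i. real (card {z \<in> Z i. \<omega> \<in> A k z}) < 2 * \<delta> k * W i"
proof -
  define B where "B = (\<lambda>k i. {\<omega> \<in> space M. real (card {z \<in> Z i. \<omega> \<in> A k z}) \<ge> 2 * \<delta> k * W i})"
  have Wpos: "0 < W i" for i using W(2)[of i] by (smt (verit) of_nat_0_le_iff zero_less_power)
  have p0: "0 \<le> p k" for k using prob_le[of k undefined] measure_nonneg[of M "A k undefined"]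
    by linarith
  have count_measurable: "(\<lambda>\<omega>. real (card {z \<in> Z i. \<omega> \<in> A k z})) \<in> borel_measurable M" for k i
  proof -
    have "real (card {z \<in> Z i. \<omega> \<in> A k z}) = (\<Sum>z\<in>Z i. indicator (A k z) \<omega>)" for \<omega>
      using fin by (simp add: indicator_def sum.If_cases Int_def)
    moreover have "(\<lambda>\<omega>. \<Sum>z\<in>Z i. indicator (A k z) \<omega> :: real) \<in> borel_measurable M"
      using ev by (intro borel_measurable_sum) auto
    ultimately show ?thesis by simp
  qed
  then have meas: "B k i \<in> events" for k i unfolding B_def by simp
  have B_le: "prob (B k i) \<le> (1/2) ^ k / 8 * (1 / (real i + 1)\<^sup>2)" for k i
  proof -
    \<comment> \<open>One half of the threshold absorbs the mean, the other half is the deviation.\<close>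
    let ?l = "\<delta> k * W i"
    have "prob (B k i) \<le> prob {\<omega> \<in> space M. real (card {z \<in> Z i. \<omega> \<in> A k z}) \<ge> real (card (Z i)) * p k +
      ?l}"
    proof (rule finite_measure_mono)
      have "real (card (Z i)) * p k \<le> W i * \<delta> k"
        using W(1)[of i] \<delta>(2)[of k] p0[of k] Wpos[of i] by (intro mult_mono) auto
      then show "B k i \<subseteq> {\<omega> \<in> space M. real (card {z \<in> Z i. \<omega> \<in> A k z}) \<ge> real (card (Z i)) * p k + ?l}"
        unfolding B_def by (auto simp: algebra_simps)
    qed (use count_measurable in simp)
    also have "\<dots> \<le> real (card (Z i)) * real (\<nu> k) * p k / ?l\<^sup>2"
      using fin ev prob_le dep \<delta>(1)[of k] Wpos[of i] by (intro count_events_deviation) auto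
    also have "\<dots> \<le> W i * real (\<nu> k) * p k / ?l\<^sup>2"
      using W(1)[of i] p0[of k] by (intro divide_right_mono mult_right_mono) auto
    also have "\<dots> = (real (\<nu> k) * p k / (\<delta> k)\<^sup>2) * (1 / W i)"
      using Wpos[of i] by (simp add: power2_eq_square field_simps)
    also have "\<dots> \<le> (1/2) ^ k / 8 * (1 / (real i + 1)\<^sup>2)"
      using \<delta>(3)[of k] Wpos[of i] W(2)[of i] p0[of k]
      by (intro mult_mono divide_left_mono) (auto intro!: mult_pos_pos)
    finally show ?thesis .
  qed
  have sq: "(\<lambda>i. 1 / (real i + 1)\<^sup>2) sums (pi\<^sup>2 / 6)"
    using inverse_squares_sums by (simp add: add_ac)
  have geo: "(\<lambda>k. (1/2) ^ k / 8) sums (1/4 :: real)"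
    using sums_divide[OF geometric_sums[of "1/2::real"], of 8] by simp
  have row_sums: "(\<lambda>i. (1/2) ^ k / 8 * (1 / (real i + 1)\<^sup>2)) sums ((1/2) ^ k / 8 * (pi\<^sup>2 / 6))" for k
    by (rule sums_mult[OF sq])
  have row: "prob (\<Union>i. B k i) \<le> (1/2) ^ k / 8 * (pi\<^sup>2 / 6)" for k
  proof -
    have s: "summable (\<lambda>i. prob (B k i))"
      by (rule summable_comparison_test'[OF sums_summable[OF row_sums[of k]], of 0]) (use B_le in auto)
    have "prob (\<Union>i. B k i) \<le> (\<Sum>i. prob (B k i))"
      using meas s by (intro finite_measure_subadditive_countably) auto
    also have "\<dots> \<le> (\<Sum>i. (1/2) ^ k / 8 * (1 / (real i + 1)\<^sup>2))"
      using B_le s sums_summable[OF row_sums] by (intro suminf_le) auto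
    finally show ?thesis using sums_unique[OF row_sums[of k]] by simp
  qed
  have all_sums: "(\<lambda>k. (1/2) ^ k / 8 * (pi\<^sup>2 / 6)) sums (1/4 * (pi\<^sup>2 / 6))"
    by (rule sums_mult2[OF geo])
  have s: "summable (\<lambda>k. prob (\<Union>i. B k i))"
    by (rule summable_comparison_test'[OF sums_summable[OF all_sums], of 0]) (use row in auto)
  have "prob (\<Union>k. \<Union>i. B k i) \<le> (\<Sum>k. prob (\<Union>i. B k i))"
    using meas s by (intro finite_measure_subadditive_countably) auto
  also have "\<dots> \<le> 1/4 * (pi\<^sup>2 / 6)"
    using suminf_le[OF row s sums_summable[OF all_sums]] sums_unique[OF all_sums] by simp
  also have "\<dots> < 1"
  proof -
    have "pi\<^sup>2 < 4\<^sup>2" using pi_less_4 pi_gt_zero by (intro power_strict_mono) auto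
    then show ?thesis by simp
  qed
  finally have "prob (\<Union>k. \<Union>i. B k i) \<noteq> prob (space M)" using prob_space by simp
  then have "\<not> space M \<subseteq> (\<Union>k. \<Union>i. B k i)"
  proof (rule contrapos_nn)
    assume sub: "space M \<subseteq> (\<Union>k. \<Union>i. B k i)"
    have "(\<Union>k. \<Union>i. B k i) \<subseteq> space M" by (intro UN_least) (auto simp: B_def)
    with sub have "(\<Union>k. \<Union>i. B k i) = space M" by (rule subset_antisym[rotated])
    then show "prob (\<Union>k. \<Union>i. B k i) = prob (space M)" by (rule arg_cong)
  qed
  then obtain \<omega> where \<omega>: "\<omega> \<in> space M" "\<And>k i. \<omega> \<notin> B k i"
    unfolding subset_iff by blast
  then have "real (card {z \<in> Z i. \<omega> \<in> A k z}) < 2 * \<delta> k * W i" for k i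
    using \<omega>(2)[of k i] unfolding B_def by (simp add: not_le)
  with \<omega>(1) show ?thesis by auto
qed

section \<open>Tests on independent coordinates\<close>

lemma (in product_prob_space) indep_vars_coordinates:
  assumes "I \<noteq> {}"
  shows "prob_space.indep_vars (PiM I M) M (\<lambda>i \<omega>. \<omega> i) I"
proof -
  have "distr (PiM I M) (PiM I M) (\<lambda>\<omega>. \<lambda>i\<in>I. \<omega> i) = distr (PiM I M) (PiM I M) (\<lambda>\<omega>. \<omega>)"
    by (intro distr_cong) (auto simp: space_PiM)
  also have "\<dots> = PiM I (\<lambda>i. distr (PiM I M) (M i) (\<lambda>\<omega>. \<omega> i))"
    by (subst distr_id) (intro PiM_cong, auto simp: PiM_component)
  finally show ?thesis
    using assms by (subst P.indep_vars_iff_distr_eq_PiM') auto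
qed

text \<open>
  For a test \<open>e\<close>, the coordinates \<open>w e 0, \<dots>, w e (n-1)\<close> are compared with the targets
  \<open>H e 0, \<dots>, H e (n-1)\<close>. An outcome is bad for a family \<open>E\<close> of tests if some test misses all of its
  targets. In the application a test is a ray, and its coordinates are the cells along it.
\<close>

definition all_missed :: "('e \<Rightarrow> nat \<Rightarrow> 'z) \<Rightarrow> ('e \<Rightarrow> nat \<Rightarrow> 'b set) \<Rightarrow> nat \<Rightarrow> 'e set \<Rightarrow> ('z \<Rightarrow> 'b) set"
  where "all_missed w H n E = {\<omega>. \<exists>e\<in>E. \<forall>i<n. \<omega> (w e i) \<notin> H e i}"

context product_prob_space
begin

lemma all_missed_sets:
  fixes w :: "'e \<Rightarrow> nat \<Rightarrow> 'i"
  assumes "finite E" "\<And>e i. e \<in> E \<Longrightarrow> i < n \<Longrightarrow> w e i \<in> J \<and> H e i \<in> sets (M (w e i))"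
  shows "all_missed w H n E \<inter> space (PiM J M) \<in> sets (PiM J M)"
proof -
  have "{\<omega> \<in> space (PiM J M). \<omega> (w e i) \<notin> H e i} \<in> sets (PiM J M)" if "e \<in> E" "i < n" for e i
  proof -
    have "(\<lambda>\<omega>. \<omega> (w e i)) \<in> measurable (PiM J M) (M (w e i))"
      using assms(2)[OF that] by (intro measurable_component_singleton) simp
    from measurable_sets[OF this, of "space (M (w e i)) - H e i"] assms(2)[OF that]
    have "(\<lambda>\<omega>. \<omega> (w e i)) -` (space (M (w e i)) - H e i) \<inter> space (PiM J M) \<in> sets (PiM J M)"
      by auto
    also have "(\<lambda>\<omega>. \<omega> (w e i)) -` (space (M (w e i)) - H e i) \<inter> space (PiM J M) =
        {\<omega> \<in> space (PiM J M). \<omega> (w e i) \<notin> H e i}"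
      using assms(2)[OF that] by (auto simp: space_PiM)
    finally show ?thesis .
  qed
  then have "{\<omega> \<in> space (PiM J M). \<exists>e\<in>E. \<forall>i\<in>{..<n}. \<omega> (w e i) \<notin> H e i} \<in> sets (PiM J M)"
    using \<open>finite E\<close> by (intro sets.sets_Collect_finite_Ex sets.sets_Collect_finite_All) auto
  also have "{\<omega> \<in> space (PiM J M). \<exists>e\<in>E. \<forall>i\<in>{..<n}. \<omega> (w e i) \<notin> H e i} =
    all_missed w H n E \<inter> space (PiM J M)"
    by (auto simp: all_missed_def)
  finally show ?thesis .
qed

text \<open>
  A single test reads \<open>n\<close> different coordinates and so fails with probability at most
  \<open>(1 - h)\<^sup>n \<le> exp(- h n)\<close>; the number of tests enters through a union bound.
\<close>

lemma prob_all_missed_le: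
  fixes w :: "'e \<Rightarrow> nat \<Rightarrow> 'i"
  assumes E: "finite E" and wH: "\<And>e i. e \<in> E \<Longrightarrow> i < n \<Longrightarrow> w e i \<in> I \<and> H e i \<in> sets (M (w e i))"
    and inj: "\<And>e. e \<in> E \<Longrightarrow> inj_on (w e) {..<n}"
    and h: "\<And>e i. e \<in> E \<Longrightarrow> i < n \<Longrightarrow> h \<le> measure (M (w e i)) (H e i)"
  shows "measure (PiM I M) (all_missed w H n E \<inter> space (PiM I M)) \<le> card E * exp (- h * n)"
proof -
  have one: "measure (PiM I M) (all_missed w H n {e} \<inter> space (PiM I M)) \<le> exp (- h * n)" if e: "e \<in> E"
    for e
  proof -
    define X where "X z = space (M z) - H e (the_inv_into {..<n} (w e) z)" for z
    have X: "X (w e i) = space (M (w e i)) - H e i" if "i < n" for i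
      using that inj[OF e] by (simp add: X_def the_inv_into_f_f)
    have "all_missed w H n {e} \<inter> space (PiM I M) = {\<omega> \<in> space (PiM I M). \<forall>z\<in>w e ` {..<n}. \<omega> z \<in> X z}"
      using wH[OF e] by (auto simp: all_missed_def X space_PiM)
    moreover have "emeasure (PiM I M) \<dots> = (\<Prod>z\<in>w e ` {..<n}. emeasure (M z) (X z))"
      using wH[OF e] X by (intro emeasure_PiM_Collect) (auto intro!: sets.Diff)
    moreover have "\<dots> = ennreal (\<Prod>z\<in>w e ` {..<n}. measure (M z) (X z))"
      by (subst prod_ennreal[symmetric]) (auto intro!: prod.cong simp: M.emeasure_eq_measure)
    ultimately have "measure (PiM I M) (all_missed w H n {e} \<inter> space (PiM I M)) =
      (\<Prod>z\<in>w e ` {..<n}. measure (M z) (X z))"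
      by (simp add: measure_def prod_nonneg)
    also have "\<dots> = (\<Prod>i<n. measure (M (w e i)) (X (w e i)))"
      using inj[OF e] by (simp add: prod.reindex)
    also have "\<dots> = (\<Prod>i<n. 1 - measure (M (w e i)) (H e i))"
    proof (rule prod.cong)
      fix i assume "i \<in> {..<n}"
      then have "H e i \<in> sets (M (w e i))" "i < n" using wH[OF e] by auto
      then show "measure (M (w e i)) (X (w e i)) = 1 - measure (M (w e i)) (H e i)"
        unfolding X[OF \<open>i < n\<close>] by (intro prob_space.prob_compl M.prob_space_axioms)
    qed simp
    also have "\<dots> \<le> (\<Prod>i<n. exp (- h))"
    proof (rule prod_mono)
      fix i assume "i \<in> {..<n}"
      then have "h \<le> measure (M (w e i)) (H e i)" using h[OF e] by simp
      moreover have "1 + (- h) \<le> exp (- h)" by (rule exp_ge_add_one_self)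
      ultimately show "0 \<le> 1 - measure (M (w e i)) (H e i) \<and> 1 - measure (M (w e i)) (H e i) \<le>
        exp (- h)"
        by auto
    qed
    also have "\<dots> = exp (- h * n)" by (simp add: exp_of_nat_mult[symmetric] mult.commute)
    finally show ?thesis .
  qed
  have "all_missed w H n E \<inter> space (PiM I M) = (\<Union>e\<in>E. all_missed w H n {e} \<inter> space (PiM I M))"
    by (auto simp: all_missed_def)
  also have "measure (PiM I M) \<dots> \<le> (\<Sum>e\<in>E. measure (PiM I M) (all_missed w H n {e} \<inter> space (PiM I M)))"
  proof (rule P.finite_measure_subadditive_finite[OF E])
    have "all_missed w H n {e} \<inter> space (PiM I M) \<in> sets (PiM I M)" if "e \<in> E" for e
      by (rule all_missed_sets) (use wH that in auto)
    then show "(\<lambda>e. all_missed w H n {e} \<inter> space (PiM I M)) ` E \<subseteq> sets (PiM I M)" by blast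
  qed
  also have "\<dots> \<le> card E * exp (- h * n)"
    using sum_bounded_above[OF one, of E] by simp
  finally show ?thesis .
qed

lemma all_missed_independent:
  fixes w :: "'e \<Rightarrow> nat \<Rightarrow> 'i"
  assumes E: "finite E" "finite E'"
    and wH: "\<And>e i. e \<in> E \<union> E' \<Longrightarrow> i < n \<Longrightarrow> w e i \<in> I \<and> H e i \<in> sets (M (w e i))"
    and disj: "\<And>e i e' i'. e \<in> E \<Longrightarrow> i < n \<Longrightarrow> e' \<in> E' \<Longrightarrow> i' < n \<Longrightarrow> w e i \<noteq> w e' i'"
    and "I \<noteq> {}"
  defines "P \<equiv> PiM I M"
  shows "measure P ((all_missed w H n E \<inter> space P) \<inter> (all_missed w H n E' \<inter> space P)) =
    measure P (all_missed w H n E \<inter> space P) * measure P (all_missed w H n E' \<inter> space P)"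
proof -
  interpret R: prob_space P unfolding P_def by (rule prob_space_PiM) (rule prob_space)
  define J where "J = (\<lambda>(e, i). w e i) ` (E \<times> {..<n})"
  define J' where "J' = (\<lambda>(e, i). w e i) ` (E' \<times> {..<n})"
  have sub: "J \<subseteq> I" "J' \<subseteq> I" using wH by (auto simp: J_def J'_def)
  have "J \<inter> J' = {}" using disj by (auto simp: J_def J'_def)
  with sub have indep: "R.indep_var (PiM J M) (\<lambda>\<omega>. restrict (\<lambda>i. \<omega> i) J) (PiM J' M) (\<lambda>\<omega>. restrict (\<lambda>i. \<omega> i) J')"
    using R.indep_var_restrict[OF indep_vars_coordinates[OF \<open>I \<noteq> {}\<close>, folded P_def]] by auto
  let ?S = "all_missed w H n E \<inter> space (PiM J M)" and ?S' = "all_missed w H n E' \<inter> space (PiM J' M)"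
  have sets: "?S \<in> sets (PiM J M)" "?S' \<in> sets (PiM J' M)"
    using E wH by (auto intro!: all_missed_sets simp: J_def J'_def)
  have restr: "(\<lambda>\<omega>. restrict (\<lambda>i. \<omega> i) K) -` (all_missed w H n D \<inter> space (PiM K M)) \<inter> space P =
      all_missed w H n D \<inter> space P"
    if "K \<subseteq> I" "\<And>e i. e \<in> D \<Longrightarrow> i < n \<Longrightarrow> w e i \<in> K" for K D
  proof -
    have "restrict \<omega> K \<in> all_missed w H n D \<longleftrightarrow> \<omega> \<in> all_missed w H n D" for \<omega>
      using that(2) by (auto simp: all_missed_def)
    moreover have "restrict \<omega> K \<in> space (PiM K M)" if "\<omega> \<in> space P" for \<omega>
      using that \<open>K \<subseteq> I\<close> by (auto simp: P_def space_PiM PiE_iff)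
    ultimately show ?thesis by auto
  qed
  have r1: "(\<lambda>\<omega>. restrict (\<lambda>i. \<omega> i) J) -` ?S \<inter> space P = all_missed w H n E \<inter> space P"
    using sub by (intro restr) (auto simp: J_def)
  have r2: "(\<lambda>\<omega>. restrict (\<lambda>i. \<omega> i) J') -` ?S' \<inter> space P = all_missed w H n E' \<inter> space P"
    using sub by (intro restr) (auto simp: J'_def)
  have "(\<lambda>\<omega>. (restrict (\<lambda>i. \<omega> i) J, restrict (\<lambda>i. \<omega> i) J')) -` (?S \<times> ?S') \<inter> space P =
      (all_missed w H n E \<inter> space P) \<inter> (all_missed w H n E' \<inter> space P)"
    using r1 r2 by auto
  then show ?thesis
    using R.indep_varD[OF indep sets] unfolding r1 r2 by simp
qed

end

section \<open>Density from counts in annuli\<close>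

text \<open>
  Quadratic radii are a compromise: the ratio of consecutive radii tends to 1, so that counts in
  annuli determine the density, and in dimension at least 2 the volumes grow so fast that their
  inverses are summable. Annuli of constant width would fail the second requirement in the plane.
\<close>

definition annulus :: "nat \<Rightarrow> (real ^ 'n) set"
  where "annulus i = {y. (real i)\<^sup>2 \<le> norm y \<and> norm y < (real i + 1)\<^sup>2}"

lemma disjoint_annuli:
  assumes "y \<in> annulus i" "y \<in> annulus j"
  shows "i = j"
proof (rule ccontr)
  have "\<not> i < j" if "y \<in> annulus i" "y \<in> annulus j" for i j
  proof
    assume "i < j"
    then have "(real i + 1)\<^sup>2 \<le> (real j)\<^sup>2" by (intro power_mono) auto
    with that show False unfolding annulus_def by simp
  qed
  moreover assume "i \<noteq> j"
  ultimately show False using assms by (metis linorder_neqE_nat)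
qed

lemma in_some_annulus: "\<exists>i. y \<in> annulus i"
proof
  define i where "i = nat \<lfloor>sqrt (norm y)\<rfloor>"
  have "0 \<le> \<lfloor>sqrt (norm y)\<rfloor>" by simp
  then have *: "real i \<le> sqrt (norm y)" "sqrt (norm y) < real i + 1"
    unfolding i_def by linarith+
  have "(real i)\<^sup>2 \<le> (sqrt (norm y))\<^sup>2" using * by (intro power_mono) auto
  moreover have "(sqrt (norm y))\<^sup>2 < (real i + 1)\<^sup>2" using * by (intro power_strict_mono) auto
  ultimately show "y \<in> annulus i" unfolding annulus_def by simp
qed

lemma infinite_annulus: "infinite (annulus i :: (real ^ 'n) set)"
proof
  assume fin: "finite (annulus i :: (real ^ 'n) set)"
  let ?U = "{y :: real ^ 'n. (real i)\<^sup>2 < norm y \<and> norm y < (real i + 1)\<^sup>2}"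
  have "open ?U" by (intro open_Collect_conj open_Collect_less continuous_intros)
  moreover have "finite ?U" by (rule finite_subset[OF _ fin]) (auto simp: annulus_def)
  moreover have "((real i)\<^sup>2 + 1/2) *\<^sub>R axis undefined 1 \<in> ?U"
  proof -
    have "norm (((real i)\<^sup>2 + 1/2) *\<^sub>R axis (undefined :: 'n) (1 :: real)) = (real i)\<^sup>2 + 1/2"
      by (simp add: norm_axis_1)
    then show ?thesis by (simp add: power2_eq_square algebra_simps)
  qed
  ultimately show False using finite_imp_not_open[of ?U] by blast
qed

text \<open>
  An upper bound on the counts does not make the density converge, but exact counts do. Adding
  points is harmless because it can only shorten the visibility.
\<close>

lemma fill_annuli:
  fixes F :: "(real ^ 'n) set"
  assumes "\<And>i. finite (F \<inter> annulus i)" "\<And>i. card (F \<inter> annulus i) \<le> N i"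
  shows "\<exists>G. F \<subseteq> G \<and> (\<forall>i. finite (G \<inter> annulus i) \<and> card (G \<inter> annulus i) = N i)"
proof -
  have "\<exists>B. finite B \<and> B \<subseteq> annulus i - F \<and> card B = N i - card (F \<inter> annulus i)" for i
  proof -
    have "annulus i - F = annulus i - (F \<inter> annulus i)" by auto
    then have "infinite (annulus i - F)"
      using Diff_infinite_finite[OF assms(1) infinite_annulus] by simp
    then show ?thesis using infinite_arbitrarily_large by metis
  qed
  then obtain B where B: "\<And>i. finite (B i)" "\<And>i. B i \<subseteq> annulus i - F"
    "\<And>i. card (B i) = N i - card (F \<inter> annulus i)" by metis
  have eq: "(F \<union> (\<Union>j. B j)) \<inter> annulus i = (F \<inter> annulus i) \<union> B i" for i
    using B(2) disjoint_annuli by blast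
  have "card ((F \<inter> annulus i) \<union> B i) = N i" for i
  proof -
    have "(F \<inter> annulus i) \<inter> B i = {}" using B(2) by blast
    then show ?thesis using assms B by (simp add: card_Un_disjoint)
  qed
  then show ?thesis using assms(1) B(1) by (intro exI[of _ "F \<union> (\<Union>j. B j)"]) (auto simp: eq)
qed

lemma card_ball_from_annuli:
  fixes G :: "(real ^ 'n) set"
  assumes "\<And>i. finite (G \<inter> annulus i)" "\<And>i. card (G \<inter> annulus i) = K * ((i + 1) ^ m - i ^ m)"
    and "m > 0"
  shows "finite (G \<inter> ball 0 ((real n)\<^sup>2)) \<and> card (G \<inter> ball 0 ((real n)\<^sup>2)) = K * n ^ m"
proof (induction n)
  case 0
  then show ?case using \<open>m > 0\<close> by simp
next
  case (Suc n)
  have "(real n)\<^sup>2 \<le> (real n + 1)\<^sup>2" by (intro power_mono) auto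
  note le = less_le_trans[OF _ this]
  have eq: "G \<inter> ball 0 ((real (Suc n))\<^sup>2) = (G \<inter> ball 0 ((real n)\<^sup>2)) \<union> (G \<inter> annulus n)"
    by (auto simp: annulus_def add.commute[of 1] intro: le)
  have "card (G \<inter> ball 0 ((real (Suc n))\<^sup>2)) = K * n ^ m + K * ((n + 1) ^ m - n ^ m)"
    unfolding eq using Suc assms(1)[of n] assms(2)[of n]
    by (subst card_Un_disjoint) (auto simp: annulus_def)
  also have "\<dots> = K * Suc n ^ m"
    using power_mono[of n "n + 1" m] by (simp flip: distrib_left)
  finally show ?case using Suc assms(1)[of n] by (simp only: eq finite_Un)
qed

text \<open>
  The prescribed counts telescope to exactly \<open>K n\<^bsup>2d\<^esup>\<close> points in the ball of radius \<open>n\<^sup>2\<close>. For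
  \<open>n\<^sup>2 \<le> T < (n+1)\<^sup>2\<close> the quotient in the definition of density is squeezed between
  \<open>K ((\<surd>T - 1)\<^sup>2 / T)\<^sup>d\<close> and \<open>K ((\<surd>T + 1)\<^sup>2 / T)\<^sup>d\<close>.
\<close>

lemma finite_density_from_annuli:
  fixes G :: "(real ^ 'n) set"
  assumes "\<And>i. finite (G \<inter> annulus i)"
    "\<And>i. card (G \<inter> annulus i) = K * ((i + 1) ^ (2 * CARD('n)) - i ^ (2 * CARD('n)))"
  shows "finite_density G"
proof -
  let ?d = "CARD('n)"
  define f where "f T = real (card (G \<inter> ball 0 T)) / T ^ ?d" for T
  have ball: "finite (G \<inter> ball 0 ((real n)\<^sup>2))" "card (G \<inter> ball 0 ((real n)\<^sup>2)) = K * n ^ (2 * ?d)"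
    for n
    using card_ball_from_annuli[OF assms] by auto
  have fin: "finite (G \<inter> ball 0 T)" for T
  proof -
    obtain n where n: "T \<le> real n" using real_arch_simple by blast
    have "real n \<le> (real n)\<^sup>2" by (metis of_nat_le_iff of_nat_power power2_nat_le_imp_le le_square power2_eq_square)
    with n have "T \<le> (real n)\<^sup>2" by linarith
    then have "G \<inter> ball 0 T \<subseteq> G \<inter> ball 0 ((real n)\<^sup>2)" by (intro Int_mono subset_ball) auto
    then show ?thesis using ball(1) finite_subset by blast
  qed
  have bounds: "real K * ((sqrt T - 1)\<^sup>2 / T) ^ ?d \<le> f T \<and> f T \<le> real K * ((sqrt T + 1)\<^sup>2 / T) ^ ?d"
    if "T \<ge> 1" for T
  proof -
    define n where "n = nat \<lfloor>sqrt T\<rfloor>"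
    have "1 \<le> sqrt T" using that by simp
    then have n: "real n \<le> sqrt T" "sqrt T < real n + 1" unfolding n_def by linarith+
    have "(real n)\<^sup>2 \<le> (sqrt T)\<^sup>2" using n by (intro power_mono) auto
    then have nT: "(real n)\<^sup>2 \<le> T" using that by simp
    have "(sqrt T)\<^sup>2 \<le> (real (n + 1))\<^sup>2" using n that by (intro power_mono) auto
    then have Tn: "T \<le> (real (n + 1))\<^sup>2" using that by simp
    have "card (G \<inter> ball 0 ((real n)\<^sup>2)) \<le> card (G \<inter> ball 0 T)"
      using fin nT by (intro card_mono Int_mono subset_ball) auto
    then have "K * n ^ (2 * ?d) \<le> card (G \<inter> ball 0 T)"
      unfolding ball .
    then have "real (K * n ^ (2 * ?d)) \<le> real (card (G \<inter> ball 0 T))"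
      by (rule of_nat_mono)
    then have lo: "real K * ((real n)\<^sup>2) ^ ?d \<le> real (card (G \<inter> ball 0 T))"
      by (simp add: power_mult)
    have "card (G \<inter> ball 0 T) \<le> card (G \<inter> ball 0 ((real (n + 1))\<^sup>2))"
      using Tn by (intro card_mono[OF fin] Int_mono subset_ball) auto
    then have "card (G \<inter> ball 0 T) \<le> K * (n + 1) ^ (2 * ?d)"
      unfolding ball .
    then have "real (card (G \<inter> ball 0 T)) \<le> real (K * (n + 1) ^ (2 * ?d))"
      by (rule of_nat_mono)
    then have hi: "real (card (G \<inter> ball 0 T)) \<le> real K * ((real n + 1)\<^sup>2) ^ ?d"
      by (simp add: power_mult add.commute)
    have "(sqrt T - 1)\<^sup>2 \<le> (real n)\<^sup>2" using n \<open>1 \<le> sqrt T\<close> by (intro power_mono) auto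
    then have "real K * ((sqrt T - 1)\<^sup>2) ^ ?d \<le> real K * ((real n)\<^sup>2) ^ ?d"
      by (intro mult_left_mono power_mono[of "(sqrt T - 1)\<^sup>2"]) simp_all
    moreover have "(real n + 1)\<^sup>2 \<le> (sqrt T + 1)\<^sup>2" using n by (intro power_mono) auto
    then have "real K * ((real n + 1)\<^sup>2) ^ ?d \<le> real K * ((sqrt T + 1)\<^sup>2) ^ ?d"
      by (intro mult_left_mono power_mono[of "(real n + 1)\<^sup>2"]) simp_all
    ultimately show ?thesis using lo hi that
      unfolding f_def power_divide times_divide_eq_right
      by (intro conjI divide_right_mono) auto
  qed
  have "((\<lambda>T. (sqrt T - 1)\<^sup>2 / T) \<longlongrightarrow> 1) at_top" by real_asymp
  then have lower: "((\<lambda>T. real K * ((sqrt T - 1)\<^sup>2 / T) ^ ?d) \<longlongrightarrow> real K * 1 ^ ?d) at_top"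
    by (intro tendsto_intros)
  have "((\<lambda>T. (sqrt T + 1)\<^sup>2 / T) \<longlongrightarrow> 1) at_top" by real_asymp
  then have upper: "((\<lambda>T. real K * ((sqrt T + 1)\<^sup>2 / T) ^ ?d) \<longlongrightarrow> real K * 1 ^ ?d) at_top"
    by (intro tendsto_intros)
  have "(f \<longlongrightarrow> real K * 1 ^ ?d) at_top"
    by (rule tendsto_sandwich[OF _ _ lower upper])
      (use bounds in \<open>auto intro!: eventually_at_top_linorderI[of 1]\<close>)
  then show ?thesis using fin unfolding finite_density_def f_def by blast
qed

section \<open>Lattice points near an annulus\<close>

definition lattice_point :: "int ^ 'n \<Rightarrow> real ^ 'n" where "lattice_point z = (\<chi> j. real_of_int (z $ j))"

lemma norm_le_if_components_le:
  fixes x :: "real ^ 'n"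
  assumes "\<And>j. \<bar>x $ j\<bar> \<le> c"
  shows "norm x \<le> real CARD('n) * c"
  using norm_le_l1_cart[of x] sum_bounded_above[of UNIV "\<lambda>j. \<bar>x $ j\<bar>" c] assms by simp

text \<open>
  The open unit cubes with lower corners in \<open>Z\<close> are disjoint, have volume 1, and lie in the annulus
  widened by \<open>d\<close>, which bounds the diameter of a cube.
\<close>

lemma card_lattice_annulus:
  fixes a b :: real
  defines "Z \<equiv> {z :: int ^ 'n. a \<le> norm (lattice_point z) \<and> norm (lattice_point z) < b}"
  defines "d \<equiv> CARD('n)"
  assumes "0 \<le> b" "a \<le> b"
  shows "finite Z \<and> real (card Z) \<le> unit_ball_vol d * ((b + d) ^ d - (max 0 (a - d)) ^ d)"
proof -
  define C where "C z = box (lattice_point z) (lattice_point z + (\<chi> j. 1))" for z :: "int ^ 'n"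
  define r where "r = max 0 (a - d)"
  have mC: "measure lborel (C z) = 1" for z
  proof -
    have "cbox (lattice_point z) (lattice_point z + (\<chi> j. 1)) \<noteq> {}"
      unfolding cbox_interval by (simp add: less_eq_vec_def)
    then show ?thesis
      unfolding C_def measure_lborel_box_eq measure_lborel_cbox_eq[symmetric]
      by (simp add: content_cbox_cart)
  qed
  have C_iff: "y \<in> C z \<longleftrightarrow> (\<forall>j. real_of_int (z $ j) < y $ j \<and> y $ j < real_of_int (z $ j) + 1)" for y z
    unfolding C_def by (simp add: mem_box_cart lattice_point_def)
  have near: "norm (y - lattice_point z) \<le> d" if "y \<in> C z" for y z
    using norm_le_if_components_le[of "y - lattice_point z" 1] that unfolding C_iff d_def
    by (simp add: lattice_point_def abs_le_iff) (smt (verit))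
  have disj: "disjoint_family C"
  proof (unfold disjoint_family_on_def, intro ballI impI)
    fix z w :: "int ^ 'n" assume "z \<noteq> w"
    then obtain j where "z $ j \<noteq> w $ j" by (auto simp: vec_eq_iff)
    then have False if "y \<in> C z" "y \<in> C w" for y
      using that unfolding C_iff by (smt (verit) of_int_less_iff int_less_real_le)
    then show "C z \<inter> C w = {}" by auto
  qed
  have finC: "emeasure lborel (C z) \<noteq> \<infinity>" for z
    unfolding C_def using emeasure_lborel_box_finite[of "lattice_point z" "lattice_point z + (\<chi> j. 1)"]
      by auto
  have bound: "real (card F) \<le> unit_ball_vol d * ((b + d) ^ d - r ^ d)"
    if F: "F \<subseteq> Z" "finite F" for F
  proof -
    have sub: "(\<Union>z\<in>F. C z) \<subseteq> ball 0 (b + d) - ball 0 r"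
    proof (intro UN_least subsetI)
      fix z y assume z: "z \<in> F" and y: "y \<in> C z"
      have "\<bar>norm y - norm (lattice_point z)\<bar> \<le> d"
        using near[OF y] norm_triangle_ineq3[of y "lattice_point z"] by linarith
      moreover have "a \<le> norm (lattice_point z)" "norm (lattice_point z) < b" using z F(1)
        unfolding Z_def by auto
      ultimately have "a - d \<le> norm y" "norm y < b + d" by linarith+
      then have "r \<le> norm y" "norm y < b + d" unfolding r_def by auto
      then show "y \<in> ball 0 (b + d) - ball 0 r" by simp
    qed
    have "real (card F) = (\<Sum>z\<in>F. measure lborel (C z))" by (simp add: mC)
    also have "\<dots> = measure lborel (\<Union>z\<in>F. C z)"
      using F disj finC by (intro measure_finite_Union[symmetric])
        (auto simp: C_def disjoint_family_on_def)
    also have "\<dots> \<le> measure lborel (ball (0 :: real ^ 'n) (b + d) - ball 0 r)"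
    proof (rule measure_mono_fmeasurable[OF sub])
      show "ball 0 (b + d) - ball 0 r \<in> fmeasurable (lborel :: (real ^ 'n) measure)"
        by (intro fmeasurable_Diff fmeasurableI emeasure_lborel_ball_finite) auto
    qed (use F in \<open>auto simp: C_def\<close>)
    also have "\<dots> = measure lborel (ball (0 :: real ^ 'n) (b +
      d)) - measure lborel (ball (0 :: real ^ 'n) r)"
    proof (rule measure_Diff)
      show "ball 0 r \<subseteq> ball (0 :: real ^ 'n) (b + d)"
        using \<open>0 \<le> b\<close> \<open>a \<le> b\<close> by (intro subset_ball) (auto simp: r_def)
    qed (use emeasure_lborel_ball_finite[of "0 :: real ^ 'n" "b + d"] in auto)
    also have "\<dots> = unit_ball_vol d * ((b + d) ^ d - r ^ d)"
      using \<open>0 \<le> b\<close> by (simp add: content_ball r_def d_def algebra_simps)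
    finally show ?thesis .
  qed
  let ?C = "nat \<lfloor>unit_ball_vol d * ((b + d) ^ d - r ^ d)\<rfloor>"
  have "finite Z \<and> card Z \<le> ?C"
    by (rule finite_if_finite_subsets_card_bdd) (use bound in \<open>auto simp: le_nat_floor\<close>)
  then show ?thesis using bound[of Z] unfolding r_def by auto
qed

lemma power_diff_le:
  fixes a b :: real
  assumes "0 \<le> a" "a \<le> b"
  shows "b ^ n - a ^ n \<le> real n * (b - a) * b ^ (n - 1)"
proof (induction n)
  case (Suc n)
  have "b ^ Suc n - a ^ Suc n = b * (b ^ n - a ^ n) + (b - a) * a ^ n" by (simp add: algebra_simps)
  also have "\<dots> \<le> b * (real n * (b - a) * b ^ (n - 1)) + (b - a) * b ^ n"
    using assms Suc by (intro add_mono mult_left_mono power_mono) auto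
  also have "\<dots> = real (Suc n) * (b - a) * b ^ (Suc n - 1)"
    by (cases n) (auto simp: algebra_simps)
  finally show ?case .
qed simp


lemma power_gap_ge:
  fixes i :: nat
  assumes "m > 0"
  shows "(i + 1) ^ (m - 1) \<le> (i + 1) ^ m - i ^ m"
proof -
  obtain p where m: "m = Suc p" using assms by (cases m) auto
  have "i * i ^ p \<le> i * (i + 1) ^ p" by (intro mult_left_mono power_mono) auto
  moreover have "(i + 1) ^ m = (i + 1) ^ p + i * (i + 1) ^ p" "i ^ m = i * i ^ p"
    unfolding m by simp_all
  ultimately have "(i + 1) ^ p \<le> (i + 1) ^ m - i ^ m" by linarith
  then show ?thesis unfolding m by simp
qed

text \<open>
  Widening the annulus by a constant \<open>s\<close> does not change the order of magnitude \<open>i\<^bsup>2d-1\<^esup>\<close> of its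
  volume, which is also the order of the gap between consecutive values of \<open>i\<^bsup>2d\<^esup>\<close>.
\<close>

lemma card_cells_near_annulus:
  fixes s :: real
  defines "Z i \<equiv> {z :: int ^ 'n. (real i)\<^sup>2 - s \<le> norm (lattice_point z) \<and> norm (lattice_point z) <
    (real i + 1)\<^sup>2 + s}"
  assumes "s \<ge> 0"
  shows "\<exists>K::nat. 0 < K \<and> (\<forall>i. finite (Z i) \<and> card (Z i) \<le>
    K * ((i + 1) ^ (2 * CARD('n)) - i ^ (2 * CARD('n))))"
proof -
  define d where "d = CARD('n)"
  have d: "d > 0" unfolding d_def by simp
  \<comment> \<open>The cubes at the cells in question extend at most \<open>r\<close> beyond the annulus.\<close>
  define r where "r = s + d"
  have r: "r \<ge> 0" unfolding r_def using \<open>s \<ge> 0\<close> by simp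
  define A where "A = unit_ball_vol d * (d * (2 + 2 * r) * (1 + r) ^ (d - 1))"
  obtain K :: nat where K: "max A 1 \<le> K" using real_arch_simple by blast
  have "finite (Z i) \<and> card (Z i) \<le> K * ((i + 1) ^ (2 * d) - i ^ (2 * d))" for i
  proof -
    define a where "a = max 0 ((real i)\<^sup>2 - r)"
    define b where "b = (real i + 1)\<^sup>2 + r"
    have ab: "0 \<le> a" "a \<le> b" unfolding a_def b_def using r
      by (auto simp: power2_eq_square algebra_simps)
    have Z: "finite (Z i) \<and> real (card (Z i)) \<le> unit_ball_vol d * (b ^ d - a ^ d)"
    proof -
      have "(real i)\<^sup>2 - s - real d = (real i)\<^sup>2 - r" "(real i + 1)\<^sup>2 + s + real d = b"
        by (simp_all add: r_def b_def)
      moreover have "(real i)\<^sup>2 - s \<le> (real i + 1)\<^sup>2 + s" "0 \<le> (real i + 1)\<^sup>2 + s"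
        using \<open>s \<ge> 0\<close> by (auto simp: power2_eq_square algebra_simps)
      ultimately show ?thesis
        using card_lattice_annulus[of "(real i + 1)\<^sup>2 + s" "(real i)\<^sup>2 - s", where ?'n='n]
        unfolding Z_def a_def d_def[symmetric] by (simp only:)
    qed
    have "b - a \<le> (real i + 1)\<^sup>2 + r - ((real i)\<^sup>2 - r)" unfolding a_def b_def by simp
    also have "\<dots> \<le> (2 + 2 * r) * (real i + 1)"
      using r by (simp add: power2_eq_square algebra_simps)
    finally have diff: "b - a \<le> (2 + 2 * r) * (real i + 1)" .
    have "r * 1 \<le> r * (real i + 1)\<^sup>2" using r by (intro mult_left_mono) auto
    then have b: "b \<le> (1 + r) * (real i + 1)\<^sup>2" unfolding b_def by (simp add: distrib_right)
    have "b ^ d - a ^ d \<le> real d * (b - a) * b ^ (d - 1)" using ab by (rule power_diff_le)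
    also have "\<dots> \<le> real d * ((2 + 2 * r) * (real i + 1)) * ((1 + r) * (real i + 1)\<^sup>2) ^ (d - 1)"
      using diff b ab r by (intro mult_mono power_mono) auto
    also have "\<dots> = (d * (2 + 2 * r) * (1 + r) ^ (d - 1)) * ((real i + 1) * ((real i + 1)\<^sup>2) ^ (d - 1))"
      by (simp add: power_mult_distrib)
    also have "(real i + 1) * ((real i + 1)\<^sup>2) ^ (d - 1) = (real i + 1) ^ (2 * d - 1)"
    proof -
      have "2 * d - 1 = Suc (2 * (d - 1))" using d by simp
      then show ?thesis by (simp add: power_mult)
    qed
    finally have "unit_ball_vol d * (b ^ d - a ^ d) \<le> A * (real i + 1) ^ (2 * d - 1)"
      unfolding A_def mult.assoc by (rule mult_left_mono) simp
    also have "\<dots> \<le> real K * (real i + 1) ^ (2 * d - 1)"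
      using K by (intro mult_right_mono) auto
    also have "\<dots> = real (K * (i + 1) ^ (2 * d - 1))" by (simp add: add.commute)
    also have "\<dots> \<le> real (K * ((i + 1) ^ (2 * d) - i ^ (2 * d)))"
      using power_gap_ge[of "2 * d" i] d by (intro of_nat_mono mult_left_mono) auto
    finally show ?thesis using Z by linarith
  qed
  moreover have "0 < K" using K by (cases K) auto
  ultimately show ?thesis unfolding d_def by blast
qed

section \<open>Finite nets of rays\<close>

definition cell_of :: "real ^ 'n \<Rightarrow> int ^ 'n" where "cell_of x = (\<chi> j. \<lfloor>x $ j\<rfloor>)"

lemma cell_of_components: "0 \<le> (x - lattice_point (cell_of x)) $ j" "(x - lattice_point (cell_of x)) $ j < 1"
  by (simp_all add: lattice_point_def cell_of_def) linarith

lemma norm_diff_cell_le: "norm (x - lattice_point (cell_of x)) \<le> real CARD('n)" for x :: "real ^ 'n"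
  using norm_le_if_components_le[of "x - lattice_point (cell_of x)" 1] cell_of_components[of x]
  by (simp add: abs_le_iff less_imp_le) (smt (verit))

text \<open>
  The strict inequality matters: it makes points at distance exactly \<open>d\<close> lie in different cells.
\<close>

lemma norm_diff_less_if_same_cell:
  fixes x y :: "real ^ 'n"
  assumes "cell_of x = cell_of y"
  shows "norm (x - y) < real CARD('n)"
proof -
  have "\<bar>(x - y) $ j\<bar> < 1" for j
  proof -
    have "\<lfloor>x $ j\<rfloor> = \<lfloor>y $ j\<rfloor>" using assms by (simp add: cell_of_def vec_eq_iff)
    then show ?thesis by simp linarith
  qed
  then have "(\<Sum>j\<in>UNIV. \<bar>(x - y) $ j\<bar>) < (\<Sum>j\<in>(UNIV :: 'n set). 1)"
    by (intro sum_strict_mono) auto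
  then show ?thesis using norm_le_l1_cart[of "x - y"] by simp
qed

lemma card_vec_with_components_in:
  fixes S :: "int set"
  assumes "finite S"
  shows "finite {z :: int ^ 'n. \<forall>j. z $ j \<in> S} \<and> card {z :: int ^ 'n. \<forall>j. z $ j \<in> S} =
    card S ^ CARD('n)"
proof -
  have "bij_betw (\<lambda>f. \<chi> j. f j) (UNIV \<rightarrow>\<^sub>E S) {z :: int ^ 'n. \<forall>j. z $ j \<in> S}"
    by (rule bij_betwI[where g = "\<lambda>z. \<lambda>j. z $ j"]) (auto simp: PiE_iff)
  moreover have "finite (UNIV \<rightarrow>\<^sub>E S :: ('n \<Rightarrow> int) set)" using assms by (intro finite_PiE) auto
  moreover have "card (UNIV \<rightarrow>\<^sub>E S :: ('n \<Rightarrow> int) set) = card S ^ CARD('n)" by (simp add: card_PiE)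
  ultimately show ?thesis by (metis (no_types, lifting) bij_betw_same_card bij_betw_finite)
qed

lemma card_lattice_cube:
  fixes z :: "int ^ 'n"
  shows "finite {y :: int ^ 'n. \<forall>j. \<bar>y $ j - z $ j\<bar> \<le> int r} \<and>
    card {y :: int ^ 'n. \<forall>j. \<bar>y $ j - z $ j\<bar> \<le> int r} = (2 * r + 1) ^ CARD('n)"
proof -
  let ?S = "{- int r..int r}"
  have iff: "\<bar>a\<bar> \<le> int r \<longleftrightarrow> a \<in> ?S" for a by auto
  have bij: "bij_betw (\<lambda>y. y - z) {y. \<forall>j. \<bar>y $ j - z $ j\<bar> \<le> int r} {y. \<forall>j. y $ j \<in> ?S}"
    unfolding iff by (rule bij_betwI[where g = "\<lambda>y. y + z"]) auto
  have "card ?S = 2 * r + 1" by simp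
  then show ?thesis
    using card_vec_with_components_in[of ?S, where ?'n =
      'n] bij_betw_same_card[OF bij] bij_betw_finite[OF bij] by simp
qed

definition rays_from :: "int ^ 'n \<Rightarrow> ((real ^ 'n) \<times> (real ^ 'n)) set"
  where "rays_from z = {(x, v). cell_of x = z \<and> norm v = 1}"

text \<open>
  Starting point and direction are rounded to a mesh of width \<open>1 / N\<close>. Two rays with equal roundings
  drift apart by at most \<open>d / N + L d / N\<close> up to time \<open>L\<close>. The net consists of one actual ray for
  each occurring rounding, so that its directions are unit vectors.
\<close>

lemma exists_ray_net:
  fixes z :: "int ^ 'n"
  assumes "1 \<le> L" "0 < \<epsilon>" "4 * real CARD('n) * L \<le> \<epsilon> * real N"
  shows "\<exists>E \<subseteq> rays_from z. finite E \<and> card E \<le> (3 * N) ^ (2 * CARD('n)) \<and>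
    (\<forall>(x, v) \<in> rays_from z. \<exists>(x', v') \<in> E. \<forall>t. 0 \<le> t \<and> t \<le> L \<longrightarrow>
      norm ((x + t *\<^sub>R v) - (x' + t *\<^sub>R v')) \<le> \<epsilon> / 2)"
proof -
  let ?d = "CARD('n)"
  have N: "N > 0" using assms by (cases N) (auto simp: mult_le_0_iff)
  define g where "g = (\<lambda>e :: (real ^ 'n) \<times> (real ^ 'n).
    (cell_of (real N *\<^sub>R (fst e - lattice_point z)), cell_of (real N *\<^sub>R snd e)))"
  define A where "A = {a :: int ^ 'n. \<forall>j. a $ j \<in> {0..<int N}}"
  define B where "B = {a :: int ^ 'n. \<forall>j. a $ j \<in> {- int N..int N}}"
  have A: "finite A" "card A = N ^ ?d" and B: "finite B" "card B = (2 * N + 1) ^ ?d"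
    unfolding A_def B_def using card_vec_with_components_in[of "{0..<int N}", where ?'n = 'n]
      card_vec_with_components_in[of "{- int N..int N}", where ?'n = 'n]
        by (auto simp: nat_add_distrib nat_mult_distrib)
  have "g ` rays_from z \<subseteq> A \<times> B"
  proof (clarsimp simp: rays_from_def g_def)
    fix x v :: "real ^ 'n" assume z: "z = cell_of x" and v: "norm v = 1"
    have "0 \<le> real N * (x - lattice_point z) $ j \<and> real N * (x - lattice_point z) $ j < real N" for j
      using cell_of_components[of x j] N unfolding z by simp
    then have "cell_of (real N *\<^sub>R (x - lattice_point z)) \<in> A"
      unfolding A_def cell_of_def by (auto simp: floor_less_iff)
    moreover have "\<bar>real N * v $ j\<bar> \<le> real N" for j
      using component_le_norm_cart[of v j] v N by (simp add: abs_mult)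
    then have "- real N \<le> real N * v $ j \<and> real N * v $ j < real N + 1" for j
      by (smt (verit))
    then have "cell_of (real N *\<^sub>R v) \<in> B"
      unfolding B_def cell_of_def by (auto simp: le_floor_iff floor_le_iff)
    ultimately show "cell_of (real N *\<^sub>R (x - lattice_point (cell_of x))) \<in> A \<and> cell_of (real N *\<^sub>R v) \<in>
      B"
      unfolding z by simp
  qed
  then have im: "finite (g ` rays_from z)" "card (g ` rays_from z) \<le> N ^ ?d * (2 * N + 1) ^ ?d"
    using A B finite_subset[of _ "A \<times> B"] card_mono[of "A \<times> B"] by (auto simp: card_cartesian_product)
  define E where "E = inv_into (rays_from z) g ` g ` rays_from z"
  have "E \<subseteq> rays_from z" unfolding E_def using inv_into_into by (metis image_subsetI)
  moreover have "finite E" using im unfolding E_def by simp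
  moreover have "card E \<le> (3 * N) ^ (2 * ?d)"
  proof -
    have "card E \<le> card (g ` rays_from z)" unfolding E_def by (rule card_image_le[OF im(1)])
    also have "\<dots> \<le> N ^ ?d * (2 * N + 1) ^ ?d" by (rule im(2))
    also have "\<dots> \<le> (3 * N) ^ ?d * (3 * N) ^ ?d"
      using N by (intro mult_mono power_mono) auto
    finally show ?thesis by (simp add: mult_2 power_add)
  qed
  moreover have "\<exists>(x', v') \<in> E. \<forall>t. 0 \<le> t \<and> t \<le> L \<longrightarrow>
      norm ((x + t *\<^sub>R v) - (x' + t *\<^sub>R v')) \<le> \<epsilon> / 2" if xv: "(x, v) \<in> rays_from z" for x v
  proof -
    obtain x' v' where e: "(x', v') = inv_into (rays_from z) g (g (x, v))" by (metis surj_pair)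
    have "g (x', v') = g (x, v)" unfolding e using xv by (simp add: f_inv_into_f)
    then have "norm (real N *\<^sub>R (x - lattice_point z) - real N *\<^sub>R (x' - lattice_point z)) \<le> ?d"
      "norm (real N *\<^sub>R v - real N *\<^sub>R v') \<le> ?d"
      unfolding g_def by (auto intro!: less_imp_le norm_diff_less_if_same_cell)
    then have N_norm: "real N * norm (x - x') \<le> ?d" "real N * norm (v - v') \<le> ?d"
      by (simp_all flip: scaleR_diff_right)
    have "norm ((x + t *\<^sub>R v) - (x' + t *\<^sub>R v')) \<le> \<epsilon> / 2" if t: "0 \<le> t" "t \<le> L" for t
    proof -
      have "norm ((x + t *\<^sub>R v) - (x' + t *\<^sub>R v')) = norm ((x - x') + t *\<^sub>R (v - v'))"
        by (simp add: algebra_simps)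
      also have "\<dots> \<le> norm (x - x') + t * norm (v - v')"
        using norm_triangle_ineq[of "x - x'" "t *\<^sub>R (v - v')"] t by simp
      finally have "real N * norm ((x + t *\<^sub>R v) - (x' + t *\<^sub>R v')) \<le>
          real N * norm (x - x') + t * (real N * norm (v - v'))"
        using N mult_left_mono[of _ _ "real N"] by (fastforce simp: algebra_simps)
      also have "\<dots> \<le> ?d * L + L * ?d"
        using N_norm t \<open>1 \<le> L\<close> N by (intro add_mono mult_mono order_trans[OF N_norm(1)]) auto
      also have "\<dots> \<le> real N * (\<epsilon> / 2)" using assms(3) by (simp add: algebra_simps)
      finally show ?thesis using N by simp
    qed
    then show ?thesis using e xv unfolding E_def by (intro bexI[of _ "(x', v')"]) auto
  qed
  ultimately show ?thesis by (intro exI[of _ E]) auto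
qed

section \<open>Windows along a ray\<close>

text \<open>
  Part of the set of points that are \<open>2\<^sup>-\<^sup>k\<^sup>-\<^sup>2\<close>-close to the unit stretch of the ray from \<open>p\<close> in
  direction \<open>v\<close>. Replacing the tube by \<open>2\<^sup>k\<close> disjoint balls keeps the volume up to a constant factor
  and makes it easy to compute.
\<close>

definition window :: "nat \<Rightarrow> real ^ 'n \<Rightarrow> real ^ 'n \<Rightarrow> (real ^ 'n) set"
  where "window k p v = (\<Union>m<2 ^ k. ball (p + (real m / 2 ^ k) *\<^sub>R v) (1 / 2 ^ (k + 2)))"

lemma measure_window:
  fixes p v :: "real ^ 'n"
  assumes "norm v = 1"
  shows "measure lborel (window k p v) =
    2 ^ k * (unit_ball_vol CARD('n) * (1 / 2 ^ (k + 2)) ^ CARD('n))"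
proof -
  let ?b = "\<lambda>m. ball (p + (real m / 2 ^ k) *\<^sub>R v) (1 / 2 ^ (k + 2))"
  have "?b m \<inter> ?b m' = {}" if "m \<noteq> m'" for m m' :: nat
  proof (rule disjoint_ballI)
    have "dist (p + (real m / 2 ^ k) *\<^sub>R v) (p + (real m' / 2 ^ k) *\<^sub>R v) =
      norm ((real m / 2 ^ k - real m' / 2 ^ k) *\<^sub>R v)"
      by (simp add: dist_norm algebra_simps)
    also have "\<dots> = \<bar>real m - real m'\<bar> / 2 ^ k"
      using assms by (simp flip: diff_divide_distrib)
    also have "\<dots> \<ge> 1 / 2 ^ k" using that by (intro divide_right_mono) auto
    finally show "1 / 2 ^ (k + 2) + 1 / 2 ^ (k + 2) \<le>
      dist (p + (real m / 2 ^ k) *\<^sub>R v) (p + (real m' / 2 ^ k) *\<^sub>R v)"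
      by (rule order_trans[rotated]) (simp add: field_simps)
  qed
  moreover have "emeasure lborel (?b m) \<noteq> \<infinity>" for m
    using emeasure_lborel_ball_finite[of "p + (real m / 2 ^ k) *\<^sub>R v" "1 / 2 ^ (k + 2)"] by simp
  ultimately have "measure lborel (window k p v) = (\<Sum>m<2 ^ k. measure lborel (?b m))"
    unfolding window_def
    by (intro measure_finite_Union)
      (simp_all add: disjoint_family_on_def image_subset_iff)
  then show ?thesis by (simp add: content_ball)
qed

text \<open>
  For \<open>r = d\<close> this is the ball from which the random offset of a cell is drawn, so that a window
  loses no volume when it is compared with the offset.
\<close>

lemma window_subset_ball:
  fixes p v :: "real ^ 'n"
  assumes "norm v = 1" "norm p \<le> r"
  shows "window k p v \<subseteq> ball 0 (r + 2)"
proof (unfold window_def, intro UN_least subsetI)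
  fix m y assume m: "m \<in> {..<(2::nat) ^ k}" and y: "y \<in>
    ball (p + (real m / 2 ^ k) *\<^sub>R v) (1 / 2 ^ (k + 2))"
  have "real m < 2 ^ k" using m by (metis lessThan_iff of_nat_less_iff of_nat_numeral of_nat_power)
  then have "norm ((real m / 2 ^ k) *\<^sub>R v) \<le> 1" using assms by simp
  moreover have "(1::real) / 2 ^ (k + 2) < 1" using one_less_power[of "2::real" "k + 2"] by simp
  moreover have "norm y \<le> norm (y - (p + (real m / 2 ^ k) *\<^sub>R v)) +
    (norm p + norm ((real m / 2 ^ k) *\<^sub>R v))"
    by (smt (verit) norm_triangle_ineq norm_triangle_sub)
  moreover have "norm (y - (p + (real m / 2 ^ k) *\<^sub>R v)) < 1 / 2 ^ (k + 2)"
    using y by (simp add: dist_norm norm_minus_commute)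
  ultimately have "norm y < r + 2" using assms(2) by linarith
  then show "y \<in> ball 0 (r + 2)" by simp
qed

section \<open>Choice of the parameters\<close>

lemma exp_dominates_power:
  fixes A B c :: real
  assumes "c > 0"
  shows "\<exists>C::nat. 0 < C \<and> A * (B * real C) ^ m \<le> exp (c * real C)"
proof -
  have "((\<lambda>x. A * (B / c) ^ m * (x ^ m / exp x)) \<longlongrightarrow> A * (B / c) ^ m * 0) at_top"
    by (intro tendsto_intros tendsto_power_div_exp_0)
  moreover have "filterlim (\<lambda>n. c * real n) at_top sequentially"
    using \<open>c > 0\<close> by (intro filterlim_tendsto_pos_mult_at_top[OF tendsto_const] filterlim_real_sequentially)
  ultimately have "((\<lambda>n. A * (B / c) ^ m * ((c * real n) ^ m / exp (c * real n))) \<longlongrightarrow>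
    A * (B / c) ^ m * 0) sequentially"
    by (rule filterlim_compose)
  then have "\<forall>\<^sub>F n in sequentially. A * (B / c) ^ m * ((c * real n) ^ m / exp (c * real n)) < 1"
    by (rule order_tendstoD) simp
  then have "\<forall>\<^sub>F n in sequentially. 0 < n \<and> A * (B / c) ^ m * ((c * real n) ^ m / exp (c * real n)) < 1"
    using eventually_gt_at_top[of 0] by eventually_elim simp
  then obtain C :: nat where C: "0 < C" "A * (B / c) ^ m * ((c * real C) ^ m / exp (c * real C)) < 1"
    using eventually_happens'[OF sequentially_bot] by blast
  have "(B / c) ^ m * (c * real C) ^ m = (B * real C) ^ m"
    using \<open>c > 0\<close> by (simp flip: power_mult_distrib)
  then have "A * (B * real C) ^ m / exp (c * real C) < 1"
    using C(2) by (simp add: mult.assoc)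
  then show ?thesis using C(1) by (intro exI[of _ C]) (simp add: divide_less_eq)
qed

text \<open>
  The number of windows of a ray at scale \<open>k\<close>. The factor \<open>2\<^bsup>k(d-1)\<^esup>\<close> compensates the probability of
  a hit in one window, so that a ray has of the order of \<open>C (k + 1)\<close> expected hits.
\<close>

definition num_windows :: "nat \<Rightarrow> nat \<Rightarrow> nat \<Rightarrow> nat"
  where "num_windows d C k = C * (k + 1) * (2 ^ k) ^ (d - 1)"

text \<open>
  The value of \<open>N\<close> that \<open>exists_ray_net\<close> requires for the length \<open>L = d n\<close>, where \<open>n\<close> is the number
  of windows, and for \<open>\<epsilon> = 2\<^sup>-\<^sup>k\<^sup>-\<^sup>1\<close>.
\<close>

definition mesh_fineness :: "nat \<Rightarrow> nat \<Rightarrow> nat \<Rightarrow> nat"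
  where "mesh_fineness d C k = 8 * d * d * num_windows d C k * 2 ^ k"

definition net_size :: "nat \<Rightarrow> nat \<Rightarrow> nat \<Rightarrow> nat"
  where "net_size d C k = (3 * mesh_fineness d C k) ^ (2 * d)"

text \<open>
  The size of the net is polynomial in \<open>C\<close> and exponential in \<open>k\<close>, with a rate independent of \<open>C\<close>,
  so \<open>exp(c C)\<close> beats all of it once \<open>C\<close> is large. A bound \<open>8 D (B C)\<^bsup>8d\<^esup> \<le> exp(c C)\<close> with \<open>B\<close> and
  \<open>D\<close> depending on \<open>d\<close> only settles all \<open>k\<close> simultaneously, by raising it to the power \<open>k + 1\<close>.
\<close>

lemma exists_length_factor:
  fixes c :: real
  assumes "c > 0" "d > 0"
  shows "\<exists>C>0. \<forall>k. 8 ^ (k + 1) * real (net_size d C k) ^ 4 \<le> exp (c * real C * (real k + 1))"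
proof -
  define B where "B = 24 * d * d"
  define D :: real where "D = (4 ^ d) ^ (8 * d)"
  obtain C where C: "0 < C" "8 * D * (real B * real C) ^ (8 * d) \<le> exp (c * real C)"
    using exp_dominates_power[OF \<open>c > 0\<close>] by blast
  have "8 ^ (k + 1) * real (net_size d C k) ^ 4 \<le> exp (c * real C * (real k + 1))" for k
  proof -
    have "k + 1 \<le> 2 ^ (k + 1)" by (intro less_imp_le less_exp)
    also have "\<dots> \<le> (2 ^ d) ^ (k + 1)" using \<open>d > 0\<close> by (intro power_mono self_le_power) auto
    finally have k: "k + 1 \<le> (2 ^ d) ^ (k + 1)" .
    have p: "(2 ^ k) ^ (d - 1) * 2 ^ k = ((2 ^ k) ^ d :: nat)"
      by (rule power_minus_mult[OF \<open>d > 0\<close>])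
    have "(2 ^ k) ^ d \<le> ((2 ^ d) ^ (k + 1) :: nat)"
      unfolding power_mult[symmetric] by (intro power_increasing) auto
    then have k2: "(k + 1) * (2 ^ k) ^ d \<le> (2 ^ d) ^ (k + 1) * (2 ^ d) ^ (k + 1)"
      using k by (intro mult_mono) auto
    have "3 * mesh_fineness d C k = B * C * ((k + 1) * ((2 ^ k) ^ (d - 1) * 2 ^ k))"
      unfolding mesh_fineness_def num_windows_def B_def by (simp add: algebra_simps)
    also have "\<dots> \<le> B * C * ((2 ^ d) ^ (k + 1) * (2 ^ d) ^ (k + 1))"
      unfolding p using k2 by (rule mult_left_mono) simp
    also have "\<dots> = B * C * (4 ^ d) ^ (k + 1)"
    proof -
      have "(2 ^ d * 2 ^ d :: nat) = 4 ^ d" by (simp flip: power_mult_distrib)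
      then show ?thesis by (simp only: power_mult_distrib[symmetric])
    qed
    finally have mesh: "3 * mesh_fineness d C k \<le> B * C * (4 ^ d) ^ (k + 1)" .
    have BC: "1 \<le> real (B * C)" unfolding B_def using \<open>d > 0\<close> C(1)
      by (simp add: Suc_le_eq flip: of_nat_mult)
    have "real (net_size d C k) ^ 4 = real (3 * mesh_fineness d C k) ^ (8 * d)"
    proof -
      have "8 * d = 2 * d * 4" by simp
      then show ?thesis unfolding net_size_def by (simp only: of_nat_power power_mult)
    qed
    also have "\<dots> \<le> real (B * C * (4 ^ d) ^ (k + 1)) ^ (8 * d)"
      using mesh by (intro power_mono of_nat_mono) auto
    also have "\<dots> = real (B * C) ^ (8 * d) * D ^ (k + 1)"
    proof -
      have "(((4::real) ^ d) ^ (k + 1)) ^ (8 * d) = D ^ (k + 1)"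
        unfolding D_def power_mult[symmetric] by (simp only: mult_ac)
      then show ?thesis by (simp only: of_nat_mult of_nat_power of_nat_numeral power_mult_distrib)
    qed
    also have "\<dots> \<le> (real (B * C) ^ (8 * d)) ^ (k + 1) * D ^ (k + 1)"
    proof (rule mult_right_mono)
      show "real (B * C) ^ (8 * d) \<le> (real (B * C) ^ (8 * d)) ^ (k + 1)"
        using one_le_power[OF BC] by (intro self_le_power) auto
    qed (simp add: D_def)
    finally have "8 ^ (k + 1) * real (net_size d C k) ^ 4 \<le>
      8 ^ (k + 1) * ((real (B * C) ^ (8 * d)) ^ (k + 1) * D ^ (k + 1))"
      by (rule mult_left_mono) simp
    also have "\<dots> = (8 * D * (real B * real C) ^ (8 * d)) ^ (k + 1)"
      by (simp only: power_mult_distrib of_nat_mult mult_ac)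
    also have "\<dots> \<le> exp (c * real C) ^ (k + 1)"
      using C(2) by (intro power_mono) (auto simp: D_def)
    also have "\<dots> = exp (c * real C * (real k + 1))"
      by (simp only: exp_of_nat_mult[symmetric]) (simp add: algebra_simps)
    finally show ?thesis .
  qed
  then show ?thesis using C(1) by blast
qed

text \<open>
  With \<open>Q\<close> the size of a net, \<open>Q / X\<close> bounds the probability of a bad cell and \<open>(1/2)\<^sup>k / Q\<close> is the
  tolerated frequency of bad cells: since a bad cell costs \<open>Q\<close> additional points, the repairs at
  scale \<open>k\<close> have density of order \<open>(1/2)\<^sup>k\<close>. These are the two conditions on these numbers in
  \<open>exists_outcome_few_bad\<close>.
\<close>

lemma deviation_parameters:
  fixes Q X \<nu> :: real
  assumes "1 \<le> Q" "8 ^ (k + 1) * Q ^ 4 \<le> X" "0 \<le> \<nu>" "\<nu> \<le> Q"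
  shows "Q / X \<le> (1/2) ^ k / Q" "\<nu> * (Q / X) / ((1/2) ^ k / Q)\<^sup>2 \<le> (1/2) ^ k / 8"
proof -
  have X: "0 < X" using assms(1,2) by (smt (verit) mult_pos_pos zero_less_power)
  have "2 ^ k * Q\<^sup>2 \<le> 8 ^ (k + 1) * Q ^ 4"
  proof (rule mult_mono)
    have "(2::real) ^ k \<le> 8 ^ k" by (intro power_mono) auto
    also have "\<dots> \<le> 8 ^ (k + 1)" by simp
    finally show "(2::real) ^ k \<le> 8 ^ (k + 1)" .
    show "Q\<^sup>2 \<le> Q ^ 4" using assms(1) by (intro power_increasing) auto
  qed auto
  with assms(2) have "2 ^ k * Q\<^sup>2 \<le> X" by linarith
  then show "Q / X \<le> (1/2) ^ k / Q"
    using X assms(1) by (simp add: field_simps power2_eq_square)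
  have "\<nu> * (Q / X) / ((1/2) ^ k / Q)\<^sup>2 = \<nu> * Q ^ 3 * 4 ^ k / X"
  proof -
    have "((2::real) ^ k)\<^sup>2 = 4 ^ k" by (simp add: power2_eq_square flip: power_mult_distrib)
    then have "((1/2) ^ k / Q)\<^sup>2 = 1 / (4 ^ k * Q\<^sup>2)"
      by (simp add: power_divide power_mult_distrib)
    then show ?thesis by (simp add: power2_eq_square power3_eq_cube)
  qed
  also have "\<dots> \<le> Q * Q ^ 3 * 4 ^ k / X"
    using assms X by (intro divide_right_mono mult_right_mono) auto
  also have "\<dots> \<le> (1/2) ^ k / 8"
  proof -
    have "(8::real) ^ k = 4 ^ k * 2 ^ k" by (simp flip: power_mult_distrib)
    then have "(Q * Q ^ 3 * 4 ^ k) * (8 * 2 ^ k) \<le> X"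
      using assms(2) by (simp add: power_numeral_reduce algebra_simps)
    then show ?thesis using X by (simp add: field_simps power_divide)
  qed
  finally show "\<nu> * (Q / X) / ((1/2) ^ k / Q)\<^sup>2 \<le> (1/2) ^ k / 8" .
qed

section \<open>Random offsets and the cells along a ray\<close>

text \<open>
  The radius is such that the ball contains every window of a ray that passes through the cell: the
  start of the window is within \<open>d\<close> of the corner of the cell, and the window extends it by less
  than 2.
\<close>

definition offset :: "(real ^ 'n) measure"
  where "offset = uniform_measure lborel (ball 0 (real CARD('n) + 2))"

lemma offset_ball_measure: "measure lborel (ball (0 :: real ^ 'n) (real CARD('n) + 2)) =
  unit_ball_vol CARD('n) * (real CARD('n) + 2) ^ CARD('n)"
  by (simp add: content_ball)

lemma offset_ball_emeasure: "emeasure lborel (ball (0 :: real ^ 'n) (real CARD('n) + 2)) \<noteq> 0"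
  "emeasure lborel (ball (0 :: real ^ 'n) (real CARD('n) + 2)) \<noteq> \<infinity>"
proof -
  show "emeasure lborel (ball (0 :: real ^ 'n) (real CARD('n) + 2)) \<noteq> \<infinity>"
    using emeasure_lborel_ball_finite[of "0 :: real ^ 'n" "real CARD('n) + 2"] by simp
  have "0 < measure lborel (ball (0 :: real ^ 'n) (real CARD('n) + 2))"
    unfolding offset_ball_measure by simp
  then show "emeasure lborel (ball (0 :: real ^ 'n) (real CARD('n) + 2)) \<noteq> 0"
    by (auto simp: measure_def)
qed

lemma prob_space_offset: "prob_space (offset :: (real ^ 'n) measure)"
  unfolding offset_def using offset_ball_emeasure by (rule prob_space_uniform_measure)

lemma sets_window: "window k p v \<in> sets (offset :: (real ^ 'n) measure)"
  unfolding offset_def window_def by simp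

text \<open>
  The expected number of hits along a ray. The volume \<open>2\<^sup>k (2\<^sup>-\<^sup>k\<^sup>-\<^sup>2)\<^sup>d\<close> of a window, up to
  constants, cancels the factor \<open>2\<^bsup>k(d-1)\<^esup>\<close> in the number of windows.
\<close>

lemma offset_window_probability:
  fixes p v :: "real ^ 'n"
  defines "d \<equiv> CARD('n)"
  assumes "norm v = 1" "norm p \<le> real d"
  shows "measure offset (window k p v) * real (num_windows d C k) =
    (1 / (4 * (real d + 2))) ^ d * real C * (real k + 1)"
proof -
  have "ball 0 (real CARD('n) + 2) \<inter> window k p v = window k p v"
    using window_subset_ball[OF assms(2,3)] unfolding d_def by auto
  moreover have "window k p v \<in> sets lborel" unfolding window_def by simp
  moreover have nonzero: "unit_ball_vol (real CARD('n)) \<noteq> 0"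
    by (rule less_imp_neq[symmetric], rule unit_ball_vol_pos) simp
  ultimately have "measure offset (window k p v) = 2 ^ k * (1 / 2 ^ (k + 2)) ^ d / (real d + 2) ^ d"
    unfolding offset_def measure_uniform_measure[OF offset_ball_emeasure \<open>window k p v \<in> sets lborel\<close>]
      offset_ball_measure d_def
    by (simp add: measure_window[OF assms(2)] nonzero)
  moreover have full: "(2::real) ^ k * (2 ^ k) ^ (d - 1) = (2 ^ k) ^ d"
    unfolding d_def by (metis power_eq_if zero_less_card_finite less_irrefl)
  moreover have "((1::real) / 2 ^ (k + 2)) ^ d = 1 / ((2 ^ k) ^ d * 4 ^ d)"
    by (simp add: power_divide power_mult_distrib)
  ultimately have "measure offset (window k p v) * real (num_windows d C k) =
      2 ^ k * (1 / ((2 ^ k) ^ d * 4 ^ d)) / (real d +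
        2) ^ d * (real C * (real k + 1) * (2 ^ k) ^ (d - 1))"
    unfolding num_windows_def by (simp add: add.commute distrib_left)
  also have "\<dots> = 2 ^ k * (2 ^ k) ^ (d - 1) * (1 / ((2 ^ k) ^ d * 4 ^ d)) / (real d +
    2) ^ d * (real C * (real k + 1))"
    by (simp only: mult_ac times_divide_eq_right times_divide_eq_left)
  also have "\<dots> = (1 / (4 ^ d * (real d + 2) ^ d)) * real C * (real k + 1)"
    unfolding full by simp
  also have "1 / (4 ^ d * (real d + 2) ^ d) = (1 / (4 * (real d + 2))) ^ d"
    by (simp only: power_divide power_mult_distrib power_one)
  finally show ?thesis .
qed

text \<open>
  Along the ray \<open>e\<close>, given by starting point and direction, windows begin at the times \<open>i d\<close>. The
  window number \<open>i\<close> is assigned to the cell that contains its initial point, and it is expressed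
  relative to the corner of this cell, for comparison with the random offset.
\<close>

definition window_cell :: "(real ^ 'n) \<times> (real ^ 'n) \<Rightarrow> nat \<Rightarrow> int ^ 'n"
  where "window_cell e i = cell_of (fst e + (real i * real CARD('n)) *\<^sub>R snd e)"

definition window_in_cell :: "nat \<Rightarrow> (real ^ 'n) \<times> (real ^ 'n) \<Rightarrow> nat \<Rightarrow> (real ^ 'n) set"
  where "window_in_cell k e i =
    window k (fst e + (real i * real CARD('n)) *\<^sub>R snd e - lattice_point (window_cell e i)) (snd e)"

lemma inj_window_cell:
  fixes e :: "(real ^ 'n) \<times> (real ^ 'n)"
  assumes "norm (snd e) = 1"
  shows "inj_on (window_cell e) I"
proof (rule inj_onI, rule ccontr)
  fix i j assume "window_cell e i = window_cell e j" "i \<noteq> j"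
  then have "norm ((real i * real CARD('n)) *\<^sub>R snd e - (real j * real CARD('n)) *\<^sub>R snd e) <
    real CARD('n)"
    unfolding window_cell_def using norm_diff_less_if_same_cell by fastforce
  moreover have "norm ((real i * real CARD('n)) *\<^sub>R snd e - (real j * real CARD('n)) *\<^sub>R snd e) =
    \<bar>real i - real j\<bar> * real CARD('n)"
    using assms by (simp flip: scaleR_diff_left left_diff_distrib add: abs_mult)
  moreover have "1 * real CARD('n) \<le> \<bar>real i - real j\<bar> * real CARD('n)"
    using \<open>i \<noteq> j\<close> by (intro mult_right_mono) auto
  ultimately show False by simp
qed

lemma window_cell_near:
  fixes e :: "(real ^ 'n) \<times> (real ^ 'n)"
  assumes "e \<in> rays_from z" "i < n"
  shows "norm (lattice_point (window_cell e i) - lattice_point z) \<le> real (CARD('n) * (n + 2))"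
proof -
  let ?d = "real CARD('n)"
  define p where "p = fst e + (real i * ?d) *\<^sub>R snd e"
  have e: "z = cell_of (fst e)" "norm (snd e) = 1" using assms(1) by (auto simp: rays_from_def)
  have "norm (p - lattice_point (window_cell e i)) \<le> ?d"
    unfolding window_cell_def p_def by (rule norm_diff_cell_le)
  moreover have "norm (fst e - lattice_point z) \<le> ?d" unfolding e by (rule norm_diff_cell_le)
  moreover have "norm (p - fst e) \<le> real n * ?d" unfolding p_def using e assms(2) by simp
  moreover have "lattice_point (window_cell e i) - lattice_point z =
    - (p - lattice_point (window_cell e i)) + (p - fst e) + (fst e - lattice_point z)"
    by simp
  then have "norm (lattice_point (window_cell e i) - lattice_point z) \<le>
      norm (p - lattice_point (window_cell e i)) + norm (p - fst e) + norm (fst e - lattice_point z)"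
    by (metis norm_minus_cancel norm_triangle_ineq norm_triangle_mono order_refl)
  ultimately show ?thesis by (simp add: algebra_simps)
qed

text \<open>
  The source of independence: at scale \<open>k\<close>, badness of a cell depends only on offsets of cells at
  distance \<open>O(n)\<close>.
\<close>

lemma cells_near_if_windows_meet:
  fixes e e' :: "(real ^ 'n) \<times> (real ^ 'n)"
  assumes "e \<in> rays_from z" "e' \<in> rays_from z'" "i < n" "i' < n" "window_cell e i = window_cell e' i'"
  shows "\<bar>z' $ j - z $ j\<bar> \<le> int (2 * CARD('n) * (n + 2))"
proof -
  have "norm (lattice_point z' - lattice_point z) \<le>
    norm (lattice_point (window_cell e i) - lattice_point z) +
      norm (lattice_point (window_cell e' i') - lattice_point z')"
    unfolding assms(5) using norm_triangle_ineq4[of "lattice_point (window_cell e' i') - lattice_point z" "lattice_point (window_cell e' i') - lattice_point z'"]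
    by simp
  also have "\<dots> \<le> real (2 * CARD('n) * (n + 2))"
    using window_cell_near[OF assms(1,3)] window_cell_near[OF assms(2,4)] by simp
  finally have "\<bar>(lattice_point z' - lattice_point z) $ j\<bar> \<le> real (2 * CARD('n) * (n + 2))"
    using component_le_norm_cart[of "lattice_point z' - lattice_point z" j] by linarith
  then have "real_of_int \<bar>z' $ j - z $ j\<bar> \<le> real_of_int (int (2 * CARD('n) * (n + 2)))"
    by (simp only: lattice_point_def) simp
  then show ?thesis by (simp only: of_int_le_iff)
qed

section \<open>The random forest and its repairs\<close>

lemma sum_half_powers_le: "(\<Sum>k<m. (1/2) ^ k) \<le> (2::real)"
proof -
  have "(\<Sum>k<m. (1/2) ^ k) = 2 - 2 * (1/2 :: real) ^ m" by (induction m) auto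
  then show ?thesis by simp
qed

text \<open>
  Repairs contribute to an annulus at finitely many scales only, because eventually the bound on the
  number of bad cells drops below 1; the geometric series bounds the total.
\<close>

lemma card_repair_points_le:
  fixes E :: "nat \<Rightarrow> 'z \<Rightarrow> 'e set" and Q :: "nat \<Rightarrow> nat" and W :: real
  assumes fin: "\<And>k. finite (B k)" and E: "\<And>k z. finite (E k z)" "\<And>k z. card (E k z) \<le> Q k"
    and Q: "\<And>k. 1 \<le> Q k"
    and B: "\<And>k. real (card (B k)) < 2 * ((1/2) ^ k / real (Q k)) * W" and W: "0 \<le> W"
  shows "finite (\<Union>k. \<Union>z\<in>B k. f ` E k z)" "real (card (\<Union>k. \<Union>z\<in>B k. f ` E k z)) \<le> 4 * W"
proof -
  have QB: "real (Q k) * real (card (B k)) \<le> 2 * (1/2) ^ k * W" for k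
    using B[of k] Q[of k] by (simp add: field_simps)
  have "(\<lambda>k. 2 * W * (1/2) ^ k) \<longlonglongrightarrow> 2 * W * 0"
    by (intro tendsto_intros LIMSEQ_realpow_zero) auto
  then have "\<forall>\<^sub>F k in sequentially. 2 * W * (1/2) ^ k < 1"
    by (rule order_tendstoD) simp
  then obtain m where m: "\<And>k. k \<ge> m \<Longrightarrow> 2 * W * (1/2) ^ k < 1"
    unfolding eventually_sequentially by blast
  have empty: "B k = {}" if "k \<ge> m" for k
  proof -
    have "real (card (B k)) \<le> real (Q k) * real (card (B k))"
      using Q[of k] by (simp add: mult_le_cancel_right1)
    also have "\<dots> < 1" using QB[of k] m[OF that] by (simp add: mult_ac)
    finally show ?thesis using fin[of k] by simp
  qed
  have eq: "(\<Union>k. \<Union>z\<in>B k. f ` E k z) = (\<Union>k<m. \<Union>z\<in>B k. f ` E k z)" (is "?U = ?V")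
  proof
    show "?U \<subseteq> ?V"
    proof (intro UN_least)
      fix k z assume "z \<in> B k"
      then have "k < m" using empty[of k] by (cases "k < m") auto
      with \<open>z \<in> B k\<close> show "f ` E k z \<subseteq> ?V" by blast
    qed
  qed blast
  show "finite (\<Union>k. \<Union>z\<in>B k. f ` E k z)" unfolding eq using fin E by auto
  have "card ?V \<le> (\<Sum>k<m. card (\<Union>z\<in>B k. f ` E k z))" by (rule card_UN_le) simp
  also have "\<dots> \<le> (\<Sum>k<m. Q k * card (B k))"
  proof (rule sum_mono)
    fix k
    have "card (\<Union>z\<in>B k. f ` E k z) \<le> (\<Sum>z\<in>B k. card (f ` E k z))" by (rule card_UN_le[OF fin])
    also have "\<dots> \<le> (\<Sum>z\<in>B k. Q k)"
      by (intro sum_mono order_trans[OF card_image_le[OF E(1)] E(2)])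
    finally show "card (\<Union>z\<in>B k. f ` E k z) \<le> Q k * card (B k)" by (simp add: mult.commute)
  qed
  finally have "real (card ?V) \<le> real (\<Sum>k<m. Q k * card (B k))" by (rule of_nat_mono)
  also have "\<dots> = (\<Sum>k<m. real (Q k) * real (card (B k)))" by simp
  also have "\<dots> \<le> (\<Sum>k<m. 2 * (1/2) ^ k * W)" by (intro sum_mono QB)
  also have "\<dots> = 2 * W * (\<Sum>k<m. (1/2) ^ k)" by (simp add: sum_distrib_left mult_ac)
  also have "\<dots> \<le> 2 * W * 2" using W by (intro mult_left_mono sum_half_powers_le) auto
  finally show "real (card (\<Union>k. \<Union>z\<in>B k. f ` E k z)) \<le> 4 * W" unfolding eq by simp
qed

lemma point_in_hit_window:
  fixes e :: "(real ^ 'n) \<times> (real ^ 'n)"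
  assumes e: "e \<in> rays_from z" and i: "i < n" and u: "u \<in> window_in_cell k e i"
  shows "norm u < real CARD('n) + 2"
    and "\<exists>t. 0 \<le> t \<and> t \<le> real (CARD('n) * n) \<and>
      norm (fst e + t *\<^sub>R snd e - (lattice_point (window_cell e i) + u)) \<le> 1 / 2 ^ (k + 2)"
proof -
  let ?d = "real CARD('n)"
  have v: "norm (snd e) = 1" using e by (auto simp: rays_from_def)
  define p where "p = fst e + (real i * ?d) *\<^sub>R snd e"
  have "norm (p - lattice_point (window_cell e i)) \<le> ?d"
    unfolding window_cell_def p_def by (rule norm_diff_cell_le)
  then have "window_in_cell k e i \<subseteq> ball 0 (?d + 2)"
    unfolding window_in_cell_def p_def[symmetric] using v by (intro window_subset_ball)
  then show "norm u < ?d + 2" using u by auto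
  obtain m where m: "m < (2::nat) ^ k"
    "u \<in> ball (p - lattice_point (window_cell e i) + (real m / 2 ^ k) *\<^sub>R snd e) (1 / 2 ^ (k + 2))"
    using u unfolding window_in_cell_def p_def[symmetric] window_def by blast
  define t where "t = real i * ?d + real m / 2 ^ k"
  have "real m < 2 ^ k" using m(1) by (metis of_nat_less_iff of_nat_numeral of_nat_power)
  then have "real m / 2 ^ k \<le> 1" by simp
  also have "1 \<le> ?d" by (simp add: Suc_le_eq)
  finally have "t \<le> (real i + 1) * ?d" unfolding t_def by (simp add: distrib_right)
  also have "\<dots> \<le> real n * ?d" using i by (intro mult_right_mono) auto
  finally have "t \<le> real (CARD('n) * n)" by (simp add: mult.commute)
  moreover have "0 \<le> t" unfolding t_def by simp
  moreover have "fst e + t *\<^sub>R snd e - (lattice_point (window_cell e i) + u) =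
      p - lattice_point (window_cell e i) + (real m / 2 ^ k) *\<^sub>R snd e - u"
    unfolding p_def t_def by (simp add: algebra_simps)
  then have "norm (fst e + t *\<^sub>R snd e - (lattice_point (window_cell e i) + u)) \<le> 1 / 2 ^ (k + 2)"
    using m(2) by (simp only: mem_ball dist_norm less_imp_le)
  ultimately show "\<exists>t. 0 \<le> t \<and> t \<le> real (CARD('n) * n) \<and>
      norm (fst e + t *\<^sub>R snd e - (lattice_point (window_cell e i) + u)) \<le> 1 / 2 ^ (k + 2)" by blast
qed

lemma num_windows_ge_1: "0 < C \<Longrightarrow> 1 \<le> num_windows d C k"
  unfolding num_windows_def by (simp add: Suc_le_eq)

text \<open>
  A crude comparison that spares a separate parameter for the number of dependent cells.
\<close>

lemma dependent_cells_le_net_size: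
  assumes "0 < C" "0 < d"
  shows "(2 * (2 * d * (num_windows d C k + 2)) + 1) ^ d \<le> net_size d C k"
proof -
  define n where "n = num_windows d C k"
  have n: "1 \<le> n" unfolding n_def by (rule num_windows_ge_1[OF assms(1)])
  have dn: "1 \<le> d * n" "d \<le> d * n" using n assms(2) by (auto simp: Suc_le_eq)
  have "2 * (2 * d * (n + 2)) + 1 = 4 * (d * n) + 8 * d + 1" by (simp add: algebra_simps)
  also have "\<dots> \<le> 24 * (d * n)" using dn by linarith
  also have "\<dots> \<le> 24 * (d * n) * (d * 2 ^ k)" using assms(2) by (simp add: Suc_le_eq)
  also have "\<dots> = 3 * mesh_fineness d C k" unfolding mesh_fineness_def n_def by (simp add: algebra_simps)
  finally have le: "2 * (2 * d * (n + 2)) + 1 \<le> 3 * mesh_fineness d C k" .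
  then have "(2 * (2 * d * (n + 2)) + 1) ^ d \<le> (3 * mesh_fineness d C k) ^ d" by (intro power_mono) auto
  also have "\<dots> \<le> net_size d C k"
    unfolding net_size_def using le by (intro power_increasing) auto
  finally show ?thesis unfolding n_def .
qed

text \<open>
  The random construction with its repairs. Scale \<open>k\<close> stands for \<open>\<epsilon> = 2\<^sup>-\<^sup>k\<^sup>-\<^sup>1\<close>; half of this
  distance is spent on replacing a ray by one in the net, the other half on the hit.
\<close>

lemma exists_random_forest:
  assumes "CARD('n::finite) \<ge> 2"
  defines "d \<equiv> CARD('n)"
  shows "\<exists>(F :: (real ^ 'n) set) C K :: nat. 0 < C \<and>
    (\<forall>i. finite (F \<inter> annulus i) \<and> card (F \<inter> annulus i) \<le> K * ((i + 1) ^ (2 * d) - i ^ (2 * d))) \<and>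
    (\<forall>k x v. norm v = 1 \<longrightarrow> (\<exists>t y. 0 \<le> t \<and> t \<le> real (d * num_windows d C k) \<and> y \<in> F \<and>
      norm (x + t *\<^sub>R v - y) \<le> 1 / 2 ^ (k + 1)))"
proof -
  have d: "2 \<le> d" using assms by simp
  define c where "c = (1 / (4 * (real d + 2))) ^ d"
  have c: "0 < c" unfolding c_def by simp
  obtain C where C: "0 < C"
    and large: "\<And>k. 8 ^ (k + 1) * real (net_size d C k) ^ 4 \<le> exp (c * real C * (real k + 1))"
    using exists_length_factor[OF c, of d] d by auto
  define n where "n k = num_windows d C k" for k
  define Q where "Q k = net_size d C k" for k
  have n1: "1 \<le> n k" for k unfolding n_def by (rule num_windows_ge_1[OF C])
  have Q1: "1 \<le> Q k" for k
    unfolding Q_def using dependent_cells_le_net_size[OF C, of d k] d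
    by (metis add_gr_0 less_le_trans less_one not_less pos2 zero_less_power)
  define is_net where "is_net k z E \<longleftrightarrow> E \<subseteq> rays_from z \<and> finite E \<and> card E \<le> Q k \<and>
      (\<forall>(x, v) \<in> rays_from z. \<exists>(x', v') \<in> E. \<forall>t. 0 \<le> t \<and> t \<le> real (d * n k) \<longrightarrow>
        norm ((x + t *\<^sub>R v) - (x' + t *\<^sub>R v')) \<le> 1 / 2 ^ (k + 1) / 2)"
    for k and z :: "int ^ 'n" and E
  have "\<exists>E. is_net k z E" for k and z :: "int ^ 'n"
    unfolding is_net_def Q_def net_size_def d_def
  proof (rule exists_ray_net)
    have "1 \<le> d * n k" using n1[of k] d by simp
    then show "1 \<le> real (CARD('n) * n k)" unfolding d_def[symmetric] by (metis of_nat_1 of_nat_le_iff)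
    show "4 * real CARD('n) * real (CARD('n) * n k) \<le>
      1 / 2 ^ (k + 1) * real (mesh_fineness CARD('n) C k)"
      unfolding mesh_fineness_def n_def d_def[symmetric] by simp
  qed simp
  then obtain E :: "nat \<Rightarrow> int ^ 'n \<Rightarrow> ((real ^ 'n) \<times> (real ^ 'n)) set" where
    is_net: "\<And>k z. is_net k z (E k z)" by metis
  then have E: "\<And>k z. E k z \<subseteq> rays_from z" "\<And>k z. finite (E k z)" "\<And>k z. card (E k z) \<le> Q k"
    unfolding is_net_def by auto
  have net: "\<exists>(x', v') \<in> E k z. \<forall>t. 0 \<le> t \<and> t \<le> real (d * n k) \<longrightarrow>
      norm ((x + t *\<^sub>R v) - (x' + t *\<^sub>R v')) \<le> 1 / 2 ^ (k + 1) / 2"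
    if "(x, v) \<in> rays_from z" for k z x v
    using is_net[of k z] that unfolding is_net_def by fast
  define Z where "Z i = {z :: int ^ 'n. (real i)\<^sup>2 - (real d + 2) \<le> norm (lattice_point z) \<and>
    norm (lattice_point z) < (real i + 1)\<^sup>2 + (real d + 2)}" for i :: nat
  obtain K :: nat where K: "0 < K" "\<And>i. finite (Z i)"
    "\<And>i. card (Z i) \<le> K * ((i + 1) ^ (2 * d) - i ^ (2 * d))"
    using card_cells_near_annulus[of "real d + 2", where ?'n = 'n] unfolding Z_def d_def by auto
  define W where "W i = real (K * ((i + 1) ^ (2 * d) - i ^ (2 * d)))" for i
  have W: "(real i + 1)\<^sup>2 \<le> W i" for i
  proof -
    have "(i + 1)\<^sup>2 \<le> (i + 1) ^ (2 * d - 1)" using d by (intro power_increasing) auto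
    also have "\<dots> \<le> 1 * ((i + 1) ^ (2 * d) - i ^ (2 * d))" using power_gap_ge[of "2 * d" i] d by simp
    also have "\<dots> \<le> K * ((i + 1) ^ (2 * d) - i ^ (2 * d))" using K(1) by (intro mult_right_mono) auto
    finally have "real ((i + 1)\<^sup>2) \<le> W i" unfolding W_def by (rule of_nat_mono)
    then show ?thesis by (simp add: add.commute)
  qed
  define U where "U = (offset :: (real ^ 'n) measure)"
  interpret product_prob_space "\<lambda>_ :: int ^ 'n. U" UNIV
    unfolding U_def by (intro product_prob_spaceI prob_space_offset)
  define \<Omega> where "\<Omega> = PiM (UNIV :: (int ^ 'n) set) (\<lambda>_. U)"
  define A where "A k z = all_missed window_cell (window_in_cell k) (n k) (E k z) \<inter> space \<Omega>" for k z
  interpret R: prob_space \<Omega> unfolding \<Omega>_def by (rule P.prob_space_axioms)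
  have wH: "window_cell e i \<in> UNIV \<and> window_in_cell k e i \<in> sets U"
    for k i and e :: "(real ^ 'n) \<times> (real ^ 'n)"
    unfolding U_def window_in_cell_def using sets_window by simp
  have unit: "norm (snd e) = 1" if "e \<in> E k z" for e k z
    using E(1)[of k z] that by (auto simp: rays_from_def)
  have A_events: "A k z \<in> R.events" for k z
    unfolding A_def \<Omega>_def by (rule all_missed_sets) (use E(2) wH in auto)
  have A_prob: "R.prob (A k z) \<le> real (Q k) / exp (c * real C * (real k + 1))" for k z
  proof -
    \<comment> \<open>The hit probability of one window, read off from the expected number of hits on the ray.\<close>
    define h where "h = c * real C * (real k + 1) / real (n k)"
    have hn: "h * real (n k) = c * real C * (real k + 1)" unfolding h_def using n1[of k] by simp
    have "measure U (window_in_cell k e i) = h" if "e \<in> E k z" for e i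
    proof -
      have "norm (fst e + (real i * real CARD('n)) *\<^sub>R snd e - lattice_point (window_cell e i)) \<le>
        real CARD('n)"
        unfolding window_cell_def by (rule norm_diff_cell_le)
      from offset_window_probability[OF unit[OF that] this, of k C]
      have "measure U (window_in_cell k e i) * real (n k) = c * real C * (real k + 1)"
        unfolding U_def window_in_cell_def n_def c_def d_def .
      then show ?thesis unfolding h_def using n1[of k] by (simp add: field_simps)
    qed
    then have "R.prob (A k z) \<le> card (E k z) * exp (- h * n k)"
      unfolding A_def \<Omega>_def using E(2) wH unit
      by (intro prob_all_missed_le) (auto intro: inj_window_cell)
    also have "- h * n k = - (c * real C * (real k + 1))" using hn by simp
    also have "card (E k z) * exp (- (c * real C * (real k + 1))) \<le>
      Q k * exp (- (c * real C * (real k + 1)))"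
      using E(3)[of k z] by (intro mult_right_mono) auto
    finally show ?thesis by (simp add: exp_minus divide_inverse)
  qed
  have A_dep: "card {y \<in> Z i. R.prob (A k z \<inter> A k y) \<noteq> R.prob (A k z) * R.prob (A k y)} \<le> Q k" for k i z
  proof -
    \<comment> \<open>Events are dependent only if two of their rays share a cell.\<close>
    let ?r = "2 * d * (n k + 2)"
    have "{y \<in> Z i. R.prob (A k z \<inter> A k y) \<noteq> R.prob (A k z) * R.prob (A k y)} \<subseteq>
        {y. \<forall>j. \<bar>y $ j - z $ j\<bar> \<le> int ?r}"
    proof (clarify, rule ccontr)
      fix y j assume dep: "R.prob (A k z \<inter> A k y) \<noteq> R.prob (A k z) * R.prob (A k y)"
        and far: "\<not> \<bar>y $ j - z $ j\<bar> \<le> int ?r"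
      have "window_cell e a \<noteq> window_cell e' a'" if "e \<in> E k z" "a < n k" "e' \<in> E k y" "a' < n k"
        for e e' a a'
        using cells_near_if_windows_meet[of e z e' y a "n k" a' j] E(1) that far unfolding d_def
          by blast
      then have "R.prob (A k z \<inter> A k y) = R.prob (A k z) * R.prob (A k y)"
        unfolding A_def \<Omega>_def using E(2) wH by (intro all_missed_independent) auto
      with dep show False by simp
    qed
    then have "card {y \<in> Z i. R.prob (A k z \<inter> A k y) \<noteq> R.prob (A k z) * R.prob (A k y)} \<le>
      (2 * ?r + 1) ^ d"
      using card_lattice_cube[of z ?r] unfolding d_def by (metis (no_types, lifting) card_mono)
    also have "\<dots> \<le> Q k"
      unfolding n_def Q_def using dependent_cells_le_net_size[OF C, of d k] d by simp
    finally show ?thesis .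
  qed
  note params = deviation_parameters[of "real (Q k)" k "exp (c * real C * (real k + 1))" "real (Q k)"
    for k]
  have "\<exists>\<omega>\<in>space \<Omega>. \<forall>k i. real (card {z \<in> Z i. \<omega> \<in> A k z}) < 2 * ((1/2) ^ k / real (Q k)) * W i"
  proof (rule R.exists_outcome_few_bad[where \<nu> = Q, OF K(2) A_events A_prob A_dep])
    show "real (card (Z i)) \<le> W i" for i using K(3) unfolding W_def by (rule of_nat_mono)
    show "(real i + 1)\<^sup>2 \<le> W i" for i by (rule W)
    show "0 < (1/2) ^ k / real (Q k)" for k using Q1[of k] by simp
    show "real (Q k) / exp (c * real C * (real k + 1)) \<le> (1/2) ^ k / real (Q k)" for k
      using Q1[of k] large[of k] by (intro params(1)) (auto simp: Q_def)
    show "real (Q k) * (real (Q k) / exp (c * real C * (real k + 1))) / ((1/2) ^ k / real (Q k))\<^sup>2 \<le>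
      (1/2) ^ k / 8" for k
      using Q1[of k] large[of k] by (intro params(2)) (auto simp: Q_def)
  qed
  then obtain \<omega> where \<omega>: "\<omega> \<in> space \<Omega>"
    "\<And>k i. real (card {z \<in> Z i. \<omega> \<in> A k z}) < 2 * ((1/2) ^ k / real (Q k)) * W i" by blast
  \<comment> \<open>\<open>F0\<close> consists of the random points and \<open>F1\<close> of the repairs. The uniform measure lives on the
      whole space, so the condition on the norm discards the null event of an offset outside the ball.\<close>
  define F0 where "F0 = {lattice_point z + \<omega> z | z. norm (\<omega> z) < real d + 2}"
  define F1 where "F1 = (\<Union>k. \<Union>z\<in>{z. \<omega> \<in> A k z}. fst ` E k z)"
  have count: "finite ((F0 \<union> F1) \<inter> annulus i) \<and> card ((F0 \<union> F1) \<inter> annulus i) \<le>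
    5 * K * ((i + 1) ^ (2 * d) - i ^ (2 * d))" for i
  proof -
    have near: "z \<in> Z i" if "y \<in> annulus i" "norm (y - lattice_point z) < real d + 2" for y z
    proof -
      have "\<bar>norm y - norm (lattice_point z)\<bar> < real d + 2"
        using that(2) norm_triangle_ineq3[of y "lattice_point z"] by linarith
      then show ?thesis using that(1) unfolding annulus_def Z_def by auto
    qed
    let ?U = "\<Union>k. \<Union>z\<in>{z \<in> Z i. \<omega> \<in> A k z}. fst ` E k z"
    have sub0: "F0 \<inter> annulus i \<subseteq> (\<lambda>z. lattice_point z + \<omega> z) ` Z i"
      unfolding F0_def using near by fastforce
    have sub1: "F1 \<inter> annulus i \<subseteq> ?U"
    proof
      fix y assume y: "y \<in> F1 \<inter> annulus i"
      then obtain k z v where kz: "\<omega> \<in> A k z" "(y, v) \<in> E k z" unfolding F1_def by force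
      then have "z = cell_of y" using E(1)[of k z] by (auto simp: rays_from_def)
      then have "norm (y - lattice_point z) < real d + 2"
        using norm_diff_cell_le[of y] unfolding d_def by simp
      then have "z \<in> Z i" using near y by blast
      with kz show "y \<in> ?U" by force
    qed
    have U: "finite ?U" "real (card ?U) \<le> 4 * W i"
      using card_repair_points_le[of "\<lambda>k. {z \<in> Z i. \<omega> \<in> A k z}" E Q "W i" fst] K(2) E(2,3) Q1 \<omega>(2)
      by (auto simp: W_def)
    have sub: "(F0 \<union> F1) \<inter> annulus i \<subseteq> (\<lambda>z. lattice_point z + \<omega> z) ` Z i \<union> ?U" using sub0 sub1 by blast
    have fin: "finite ((\<lambda>z. lattice_point z + \<omega> z) ` Z i \<union> ?U)" using K(2) U(1) by blast
    have "card ((F0 \<union> F1) \<inter> annulus i) \<le> card ((\<lambda>z. lattice_point z + \<omega> z) ` Z i \<union> ?U)"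
      by (rule card_mono[OF fin sub])
    also have "\<dots> \<le> card ((\<lambda>z. lattice_point z + \<omega> z) ` Z i) + card ?U" by (rule card_Un_le)
    also have "\<dots> \<le> card (Z i) + card ?U" using card_image_le[OF K(2)] by simp
    finally have "real (card ((F0 \<union> F1) \<inter> annulus i)) \<le> real (card (Z i)) + real (card ?U)"
      by (simp only: of_nat_add[symmetric] of_nat_le_iff)
    also have "\<dots> \<le> W i + 4 * W i"
      using of_nat_mono[OF K(3)[of i], where 'a = real] U(2) unfolding W_def by (rule add_mono)
    also have "\<dots> = real (5 * K * ((i + 1) ^ (2 * d) - i ^ (2 * d)))" unfolding W_def by simp
    finally have "card ((F0 \<union> F1) \<inter> annulus i) \<le> 5 * K * ((i + 1) ^ (2 * d) - i ^ (2 * d))"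
      by (simp only: of_nat_le_iff)
    then show ?thesis using finite_subset[OF sub fin] by blast
  qed
  have visible: "\<exists>t y. 0 \<le> t \<and> t \<le> real (d * n k) \<and> y \<in> F0 \<union> F1 \<and> norm (x + t *\<^sub>R v - y) \<le>
    1 / 2 ^ (k + 1)"
    if v: "norm v = 1" for k and x v :: "real ^ 'n"
  proof -
    define z where "z = cell_of x"
    have "(x, v) \<in> rays_from z" using v by (simp add: rays_from_def z_def)
    then obtain x' v' where e: "(x', v') \<in> E k z" and
      close: "\<And>t. 0 \<le> t \<Longrightarrow> t \<le> real (d * n k) \<Longrightarrow> norm ((x + t *\<^sub>R v) - (x' + t *\<^sub>R v')) \<le> 1 / 2 ^ (k + 2)"
      using net[of x v z k] by auto
    show ?thesis
    proof (cases "\<omega> \<in> A k z")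
      case True
      then have "x' \<in> F1" using e unfolding F1_def by force
      moreover have "norm (x - x') \<le> 1 / 2 ^ (k + 1)"
      proof -
        have "norm (x - x') \<le> 1 / 2 ^ (k + 2)" using close[of 0] by simp
        also have "\<dots> \<le> 1 / 2 ^ (k + 1)" by (simp add: field_simps)
        finally show ?thesis .
      qed
      ultimately have "0 \<le> (0::real) \<and> 0 \<le> real (d * n k) \<and> x' \<in> F0 \<union> F1 \<and>
          norm (x + 0 *\<^sub>R v - x') \<le> 1 / 2 ^ (k + 1)" by simp
      then show ?thesis by blast
    next
      case False
      then obtain i where i: "i < n k" "\<omega> (window_cell (x', v') i) \<in> window_in_cell k (x', v') i"
        using e \<omega>(1) unfolding A_def all_missed_def by blast
      define y where "y = lattice_point (window_cell (x', v') i) + \<omega> (window_cell (x', v') i)"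
      have ray: "(x', v') \<in> rays_from z" using e E(1) by blast
      have "norm (\<omega> (window_cell (x', v') i)) < real d + 2"
        using point_in_hit_window(1)[OF ray i] unfolding d_def .
      then have "y \<in> F0" unfolding F0_def y_def by blast
      obtain t where t: "0 \<le> t" "t \<le> real (d * n k)" "norm (x' + t *\<^sub>R v' - y) \<le> 1 / 2 ^ (k + 2)"
        using point_in_hit_window(2)[OF ray i] unfolding d_def y_def by auto
      have "norm (x + t *\<^sub>R v - y) \<le> norm ((x + t *\<^sub>R v) - (x' + t *\<^sub>R v')) + norm (x' + t *\<^sub>R v' - y)"
        using norm_triangle_ineq[of "(x + t *\<^sub>R v) - (x' + t *\<^sub>R v')" "x' + t *\<^sub>R v' - y"]
        by (simp only: add_diff_eq diff_add_cancel)
      also have "\<dots> \<le> 1 / 2 ^ (k + 2) + 1 / 2 ^ (k + 2)" using close t by (intro add_mono) auto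
      also have "\<dots> = 1 / 2 ^ (k + 1)" by (simp add: field_simps)
      finally show ?thesis using t \<open>y \<in> F0\<close> by blast
    qed
  qed
  show ?thesis
    using C count visible unfolding n_def
      by (intro exI[of _ "F0 \<union> F1"] exI[of _ C] exI[of _ "5 * K"]) blast
qed

section \<open>Visibility\<close>

text \<open>
  The set of times at which the ray is \<open>\<epsilon>\<close>-close to \<open>F\<close> is closed because \<open>F\<close> is locally finite, so
  it has a smallest element.
\<close>

lemma visibility_attained:
  fixes F :: "(real ^ 'n) set"
  assumes fin: "\<And>T. finite (F \<inter> ball 0 T)"
    and t: "0 \<le> t" "y \<in> F" "norm (x + t *\<^sub>R v - y) \<le> \<epsilon>"
  shows "\<exists>s\<le>t. is_visibility F \<epsilon> x v s"
proof -
  define T where "T = norm x + t * norm v + \<epsilon> + 1"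
  define S where "S = {s \<in> {0..t}. \<exists>y\<in>F. norm (x + s *\<^sub>R v - y) \<le> \<epsilon>}"
  have "S = (\<Union>y\<in>F \<inter> ball 0 T. {0..t} \<inter> {s. norm (x + s *\<^sub>R v - y) \<le> \<epsilon>})"
  proof -
    have "norm y < T" if "s \<in> {0..t}" "norm (x + s *\<^sub>R v - y) \<le> \<epsilon>" for s y
    proof -
      have "norm y \<le> norm (x + s *\<^sub>R v) + norm (x + s *\<^sub>R v - y)"
        by (metis norm_minus_commute norm_triangle_sub)
      moreover have "norm (x + s *\<^sub>R v) \<le> norm x + s * norm v"
        using that norm_triangle_ineq[of x "s *\<^sub>R v"] by simp
      moreover have "s * norm v \<le> t * norm v" using that by (intro mult_right_mono) auto
      ultimately show ?thesis using that unfolding T_def by linarith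
    qed
    then show ?thesis unfolding S_def by auto
  qed
  moreover have "compact ({0..t} \<inter> {s. norm (x + s *\<^sub>R v - y) \<le> \<epsilon>})" for y
    by (intro compact_Int_closed closed_Collect_le continuous_intros) auto
  ultimately have "compact S" using fin by (simp only:) (intro compact_UN)
  moreover have "t \<in> S" using t unfolding S_def by auto
  ultimately obtain s where s: "s \<in> S" "\<And>r. r \<in> S \<Longrightarrow> s \<le> r"
    using compact_attains_inf[of S] by auto
  have "is_visibility F \<epsilon> x v s"
    unfolding is_visibility_def
  proof (intro conjI allI impI)
    fix r assume r: "0 \<le> r" "\<exists>y\<in>F. norm (x + r *\<^sub>R v - y) \<le> \<epsilon>"
    show "s \<le> r"
    proof (cases "r \<le> t")
      case True
      then show ?thesis using r by (intro s(2)) (auto simp: S_def)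
    next
      case False
      then show ?thesis using s(1) by (auto simp: S_def)
    qed
  qed (use s(1) in \<open>auto simp: S_def\<close>)
  moreover have "s \<le> t" using s(1) by (auto simp: S_def)
  ultimately show ?thesis by blast
qed

theorem theorem1p1:
  assumes "CARD('n::finite) \<ge> 2"
  shows "\<exists>(F :: (real ^ 'n) set) (V :: real \<Rightarrow> real).
           dense_forest F \<and> visibility_function F V \<and>
           V \<in> O[at_right 0](\<lambda>\<epsilon>. \<epsilon> powr (- (real CARD('n) - 1)) * ln (inverse \<epsilon>))"
proof -
  define d where "d = CARD('n)"
  have d: "2 \<le> d" using assms unfolding d_def .
  obtain F :: "(real ^ 'n) set" and C K :: nat where "0 < C"
    and count: "\<And>i. finite (F \<inter> annulus i)" "\<And>i. card (F \<inter> annulus i) \<le>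
      K * ((i + 1) ^ (2 * d) - i ^ (2 * d))"
    and visible: "\<And>k x v. norm v = 1 \<Longrightarrow> \<exists>t y. 0 \<le> t \<and> t \<le> real (d * num_windows d C k) \<and> y \<in> F \<and>
      norm (x + t *\<^sub>R v - y) \<le> 1 / 2 ^ (k + 1)"
    using exists_random_forest[OF assms, folded d_def] by blast
  obtain G where G: "F \<subseteq> G" "\<And>i. finite (G \<inter> annulus i)"
    "\<And>i. card (G \<inter> annulus i) = K * ((i + 1) ^ (2 * d) - i ^ (2 * d))"
    using fill_annuli[OF count] by blast
  have dens: "finite_density G" using finite_density_from_annuli[OF G(2) G(3)[unfolded d_def]] .
  then have fin: "finite (G \<inter> ball 0 T)" for T unfolding finite_density_def by blast
  \<comment> \<open>For \<open>2\<^sup>-\<^sup>k\<^sup>-\<^sup>1 \<le> \<epsilon> \<le> 2\<^sup>-\<^sup>k\<close> the length \<open>d C (k+1) 2\<^bsup>k(d-1)\<^esup>\<close> suffices, with \<open>2\<^sup>k \<le> 1/\<epsilon>\<close> and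
      \<open>k + 1 \<le> 2 log\<^sub>2 (1/\<epsilon>)\<close> as soon as \<open>\<epsilon> < 1/2\<close>. For larger \<open>\<epsilon>\<close> the scale \<open>k = 0\<close> is used.\<close>
  define A where "A = 2 * real d * real C / ln 2"
  define V where "V \<epsilon> = (if \<epsilon> < 1/2 then A * (\<epsilon> powr (- (real d - 1)) * ln (inverse \<epsilon>)) else real d * real C)" for \<epsilon> :: real
  have A: "0 \<le> A" unfolding A_def by simp
  have scale: "\<exists>k. 1 / 2 ^ (k + 1) \<le> \<epsilon> \<and> real (d * num_windows d C k) \<le> V \<epsilon>" if "\<epsilon> > 0" for \<epsilon>
  proof (cases "\<epsilon> < 1/2")
    case False
    then show ?thesis by (intro exI[of _ 0]) (simp add: num_windows_def V_def)
  next
    case True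
    define l where "l = log 2 (inverse \<epsilon>)"
    have "inverse (1/2) \<le> inverse \<epsilon>" using True \<open>\<epsilon> > 0\<close> by (intro le_imp_inverse_le) auto
    then have "log 2 2 \<le> l" unfolding l_def using \<open>\<epsilon> > 0\<close> by (subst log_le_cancel_iff) auto
    then have l1: "1 \<le> l" by simp
    define k where "k = nat \<lfloor>l\<rfloor>"
    have k: "real k \<le> l" "l < real k + 1" unfolding k_def using l1 by linarith+
    have l_powr: "2 powr l = inverse \<epsilon>" unfolding l_def using \<open>\<epsilon> > 0\<close> by simp
    have "inverse \<epsilon> \<le> 2 powr (real (k + 1))" unfolding l_powr[symmetric] using k
      by (intro powr_mono) auto
    also have "\<dots> = 2 ^ (k + 1)" by (rule powr_realpow) simp
    finally have "1 / 2 ^ (k + 1) \<le> \<epsilon>" using \<open>\<epsilon> > 0\<close> by (simp add: field_simps)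
    moreover have "real (d * num_windows d C k) \<le> V \<epsilon>"
    proof -
      have "2 ^ k = 2 powr real k" by (rule powr_realpow[symmetric]) simp
      also have "\<dots> \<le> inverse \<epsilon>" unfolding l_powr[symmetric] using k by (intro powr_mono) auto
      finally have "(2 ^ k) ^ (d - 1) \<le> inverse \<epsilon> ^ (d - 1)" by (intro power_mono) auto
      also have "\<dots> = inverse \<epsilon> powr real (d - 1)" using \<open>\<epsilon> > 0\<close> by (intro powr_realpow[symmetric]) auto
      also have "\<dots> = \<epsilon> powr (- (real d - 1))"
      proof -
        have "- (real d - 1) = - real (d - 1)" using d by simp
        then show ?thesis using \<open>\<epsilon> > 0\<close> by (simp only: powr_minus inverse_powr less_imp_le)
      qed
      finally have a: "(2 ^ k) ^ (d - 1) \<le> \<epsilon> powr (- (real d - 1))" .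
      have b: "real k + 1 \<le> 2 * l" using k l1 by linarith
      have "real (d * num_windows d C k) = real d * real C * ((real k + 1) * (2 ^ k) ^ (d - 1))"
        unfolding num_windows_def by (simp add: algebra_simps)
      also have "\<dots> \<le> real d * real C * (2 * l * \<epsilon> powr (- (real d - 1)))"
        using a b l1 by (intro mult_left_mono mult_mono) auto
      also have "\<dots> = V \<epsilon>" unfolding V_def A_def l_def log_def using True by simp
      finally show ?thesis .
    qed
    ultimately show ?thesis by blast
  qed
  have vis: "visibility_function G V"
    unfolding visibility_function_def
  proof (intro conjI allI impI ballI)
    fix \<epsilon> :: real assume "0 < \<epsilon>"
    from scale[OF this] show "0 \<le> V \<epsilon>" using of_nat_0_le_iff order_trans by blast
  next
    fix x v :: "real ^ 'n" and \<epsilon> :: real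
    assume v: "v \<in> sphere 0 1" and "0 < \<epsilon>"
    obtain k where k: "1 / 2 ^ (k + 1) \<le> \<epsilon>" "real (d * num_windows d C k) \<le> V \<epsilon>"
      using scale[OF \<open>0 < \<epsilon>\<close>] by blast
    obtain t y where ty: "0 \<le> t" "t \<le> real (d * num_windows d C k)" "y \<in> F"
      "norm (x + t *\<^sub>R v - y) \<le> 1 / 2 ^ (k + 1)"
      using visible[of v k x] v by auto
    have "\<exists>s\<le>t. is_visibility G \<epsilon> x v s"
    proof (rule visibility_attained[OF fin])
      show "norm (x + t *\<^sub>R v - y) \<le> \<epsilon>" using ty(4) k(1) by linarith
    qed (use ty G(1) in auto)
    then show "\<exists>t. is_visibility G \<epsilon> x v t \<and> t \<le> V \<epsilon>" using ty(2) k(2) by (meson order_trans)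
  qed
  have "V \<in> O[at_right 0](\<lambda>\<epsilon>. \<epsilon> powr (- (real d - 1)) * ln (inverse \<epsilon>))"
  proof (rule bigoI)
    have "\<forall>\<^sub>F \<epsilon> in at_right 0. \<epsilon> \<in> {0<..<1/2::real}" by (rule eventually_at_right_real) simp
    then show "\<forall>\<^sub>F \<epsilon> in at_right 0. norm (V \<epsilon>) \<le> A * norm (\<epsilon> powr (- (real d - 1)) * ln (inverse \<epsilon>))"
      by eventually_elim (use A in \<open>simp add: V_def abs_mult\<close>)
  qed
  then show ?thesis using dens vis unfolding d_def dense_forest_def by blast
qed

end
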